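(* Let $\rho_{A_1A_2\cdots A_n}$ be an $n$-qubit state, and let $k\geq 1$, $\frac12\leq p\leq 1$, $r\geq 2$, $0\leq\alpha\leq\frac r2$. Put $l=\frac{(1+k)^{\alpha/r}-p^{\alpha/r}}{k^{\alpha/r}}$. Write $C_{A_1A_i}=C(\rho_{A_1A_i})$ for $i=2,\dots,n$ and $C_{A_1|A_{j+1}\cdots A_n}=C(\rho_{A_1|A_{j+1}\cdots A_n})$ for $j=1,\dots,n-1$ (so $C_{A_1|A_n}=C_{A_1A_n}$). (1) Let $n\geq 4$ and $2\leq m\leq n-2$. If $k\,C^r_{A_1A_i}\leq C^r_{A_1|A_{i+1}\cdots A_n}$ for $i=2,\dots,m$ and $C^r_{A_1A_j}\geq k\,C^r_{A_1|A_{j+1}\cdots A_n}$ for $j=m+1,\dots,n-1$, then $$C^\alpha_{A_1|A_2\cdots A_n}\geq p^{\alpha/r}\big(C^\alpha_{A_1A_2}+lC^\alpha_{A_1A_3}+\cdots+l^{m-2}C^\alpha_{A_1A_m}\big)+l^m\big[C^\alpha_{A_1A_{m+1}}+p^{\alpha/r}C^\alpha_{A_1A_{m+2}}+\cdots+p^{(n-m-2)\alpha/r}C^\alpha_{A_1A_{n-1}}\big]+l^{m-1}p^{(n-m-1)\alpha/r}C^\alpha_{A_1A_n}.$$ (2) Let $n\geq 3$. If $k\,C^r_{A_1A_i}\leq C^r_{A_1|A_{i+1}\cdots A_n}$ for $i=2,\dots,n-1$, then $$C^\alpha_{A_1|A_2\cdots A_n}\geq p^{\alpha/r}\big(C^\alpha_{A_1A_2}+lC^\alpha_{A_1A_3}+\cdots+l^{n-3}C^\alpha_{A_1A_{n-1}}\big)+l^{n-2}C^\alpha_{A_1A_n}.$$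 (3) Let $n\geq 3$. If $C^r_{A_1A_j}\geq k\,C^r_{A_1|A_{j+1}\cdots A_n}$ for $j=2,\dots,n-1$, then $$C^\alpha_{A_1|A_2\cdots A_n}\geq l\big(C^\alpha_{A_1A_2}+p^{\alpha/r}C^\alpha_{A_1A_3}+\cdots+p^{(n-3)\alpha/r}C^\alpha_{A_1A_{n-1}}\big)+p^{(n-2)\alpha/r}C^\alpha_{A_1A_n}.$$
   Context: For a bipartite pure state $|\varphi\rangle_{XY}$, its concurrence is $C(|\varphi\rangle)=\sqrt{2[1-\mathrm{tr}(\rho_X^2)]}$ with $\rho_X=\mathrm{tr}_Y|\varphi\rangle\langle\varphi|$; for a mixed bipartite state, $C(\rho_{XY})=\min\sum_ip_iC(|\varphi_i\rangle)$ over all pure-state ensembles $\{p_i,|\varphi_i\rangle\}$ of $\rho_{XY}$. For the $n$-qubit state $\rho=\rho_{A_1\cdots A_n}$, $\rho_{A_1A_i}$ is the reduced state on $A_1A_i$ (partial trace over all other qubits), $\rho_{A_1|A_{j+1}\cdots A_n}$ is the reduced state on $A_1A_{j+1}\cdots A_n$ regarded as a bipartite state for the bipartition $A_1$ versus $A_{j+1}\cdots A_n$, and $C^\alpha$ denotes the $\alpha$-th power of concurrence. *)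

theory Defs
  imports Complex_Main
begin

text \<open>Qubits are indexed by natural numbers (qubit A_i of the paper is index i-1).
  A computational basis configuration of a set S of qubits is a function
  nat => bool which is False outside S.  Operators on the Hilbert space of S
  are complex functions of two configurations; vectors are complex functions
  of one configuration.\<close>

definition configs :: "nat set \<Rightarrow> (nat \<Rightarrow> bool) set" where
  "configs S = {x. \<forall>i. i \<notin> S \<longrightarrow> x i = False}"

definition merge :: "nat set \<Rightarrow> (nat \<Rightarrow> bool) \<Rightarrow> (nat \<Rightarrow> bool) \<Rightarrow> (nat \<Rightarrow> bool)" where
  "merge T x z = (\<lambda>i. if i \<in> T then x i else z i)"

definition is_state :: "nat set \<Rightarrow> ((nat \<Rightarrow> bool) \<Rightarrow> (nat \<Rightarrow> bool) \<Rightarrow> complex) \<Rightarrow> bool" where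
  "is_state S \<rho> \<longleftrightarrow>
     (\<forall>x\<in>configs S. \<forall>y\<in>configs S. \<rho> x y = cnj (\<rho> y x)) \<and>
     (\<forall>v :: (nat \<Rightarrow> bool) \<Rightarrow> complex.
        0 \<le> Re (\<Sum>x\<in>configs S. \<Sum>y\<in>configs S. cnj (v x) * \<rho> x y * v y)) \<and>
     (\<Sum>x\<in>configs S. \<rho> x x) = 1"

definition reduced :: "nat set \<Rightarrow> nat set \<Rightarrow> ((nat \<Rightarrow> bool) \<Rightarrow> (nat \<Rightarrow> bool) \<Rightarrow> complex)
    \<Rightarrow> ((nat \<Rightarrow> bool) \<Rightarrow> (nat \<Rightarrow> bool) \<Rightarrow> complex)" where
  "reduced S T \<rho> = (\<lambda>x y. \<Sum>z\<in>configs (S - T). \<rho> (merge T x z) (merge T y z))"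

definition conc_pure :: "nat set \<Rightarrow> nat set \<Rightarrow> ((nat \<Rightarrow> bool) \<Rightarrow> complex) \<Rightarrow> real" where
  "conc_pure X Y \<psi> =
    (let \<rho>X = reduced (X \<union> Y) X (\<lambda>x y. \<psi> x * cnj (\<psi> y))
     in sqrt (2 * (1 - Re (\<Sum>x\<in>configs X. \<Sum>y\<in>configs X. \<rho>X x y * \<rho>X y x))))"

definition ensemble :: "nat set \<Rightarrow> ((nat \<Rightarrow> bool) \<Rightarrow> (nat \<Rightarrow> bool) \<Rightarrow> complex)
    \<Rightarrow> (real \<times> ((nat \<Rightarrow> bool) \<Rightarrow> complex)) list \<Rightarrow> bool" where
  "ensemble S \<rho> ens \<longleftrightarrow>
     (\<forall>(q, \<psi>) \<in> set ens. 0 \<le> q \<and> (\<Sum>x\<in>configs S. (cmod (\<psi> x))\<^sup>2) = 1) \<and>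
     (\<forall>x\<in>configs S. \<forall>y\<in>configs S.
        \<rho> x y = (\<Sum>(q, \<psi>) \<leftarrow> ens. complex_of_real q * \<psi> x * cnj (\<psi> y)))"

definition conc :: "nat set \<Rightarrow> nat set \<Rightarrow> ((nat \<Rightarrow> bool) \<Rightarrow> (nat \<Rightarrow> bool) \<Rightarrow> complex) \<Rightarrow> real" where
  "conc X Y \<rho> = Inf {(\<Sum>(q, \<psi>) \<leftarrow> ens. q * conc_pure X Y \<psi>) | ens. ensemble (X \<union> Y) \<rho> ens}"

text \<open>C_{A_1 A_i} (1-based i) for an n-qubit state rho on qubits {0..<n}.\<close>
definition C_pair :: "nat \<Rightarrow> ((nat \<Rightarrow> bool) \<Rightarrow> (nat \<Rightarrow> bool) \<Rightarrow> complex) \<Rightarrow> nat \<Rightarrow> real" where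
  "C_pair n \<rho> i = conc {0} {i - 1} (reduced {0..<n} {0, i - 1} \<rho>)"

text \<open>C_{A_1 | A_{j+1} ... A_n} (1-based j): qubits A_{j+1}..A_n are indices j..n-1.\<close>
definition C_rest :: "nat \<Rightarrow> ((nat \<Rightarrow> bool) \<Rightarrow> (nat \<Rightarrow> bool) \<Rightarrow> complex) \<Rightarrow> nat \<Rightarrow> real" where
  "C_rest n \<rho> j = conc {0} {j..<n} (reduced {0..<n} (insert 0 {j..<n}) \<rho>)"

end

theory Submission
  imports Defs "HOL-Analysis.Cartesian_Euclidean_Space" "HOL-Analysis.Determinants"
begin

text \<open>
  Everything rests on the monogamy inequality \<open>C(A|BR)\<^sup>2 \<ge> C(AB)\<^sup>2 + C(A|R)\<^sup>2\<close> for qubits \<open>A\<close>, \<open>B\<close>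
  and arbitrary \<open>R\<close>. By Minkowski's inequality it suffices to treat pure states. For a traceless
  hermitian \<open>N\<close> on \<open>B\<close> with \<open>det N = -1\<close>, measuring \<open>B\<close> in the eigenbasis of \<open>N\<close> yields a decomposition
  showing \<open>C(A|R)\<^sup>2 \<le> C(A|BR)\<^sup>2 + 4 det P\<close>, where \<open>P\<close> is the difference of the two
  unnormalised conditional states of \<open>A\<close>. So one needs some \<open>N\<close> with \<open>C(AB)\<^sup>2 \<le> - 4 det P\<close>.
  Write \<open>\<rho>\<^sub>A\<^sub>B\<close> as a sum of four rank-one operators given by matrices \<open>w\<^sub>s\<close> that are orthogonal for the
  polarised determinant (Takagi), with \<open>D\<^sub>s = det w\<^sub>s\<close> decreasing. The vectors \<open>(w\<^sub>1 \<plusminus> i w\<^sub>2)/\<surd>2\<close> and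
  \<open>(w\<^sub>3 \<plusminus> i w\<^sub>4)/\<surd>2\<close> give \<open>C(AB) \<le> 2(D\<^sub>1 - D\<^sub>2 + D\<^sub>3 - D\<^sub>4)\<close>. In the nondegenerate case the normalised
  \<open>w\<^sub>1\<^sup>-\<^sup>1 w\<^sub>s\<close> form a quaternion basis \<open>1, h\<^sub>2, h\<^sub>3, h\<^sub>4\<close>, and with the invariant form
  \<open>H = 1 + \<Sum> h\<^sub>s h\<^sub>s\<^sup>\<dagger>\<close> every \<open>N = i (c h\<^sub>2 + d h\<^sub>3) H\<close> of determinant \<open>-1\<close> satisfies
  \<open>- det P \<ge> (D\<^sub>1 - D\<^sub>2 + D\<^sub>3 - D\<^sub>4)\<^sup>2\<close>; one of them is traceless. The degenerate case follows by compactness.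
  The theorem then follows by iterating the monogamy inequality, because
  \<open>t \<mapsto> ((1 + t)\<^sup>x - p\<^sup>x) / t\<^sup>x\<close> is nondecreasing for \<open>t \<ge> 1\<close> and \<open>0 \<le> x \<le> 1/2 \<le> p\<close>.
\<close>

section \<open>Two-by-two complex matrices\<close>

text \<open>Indexing by \<open>bool\<close> matches the basis labels of a qubit. Such a matrix plays
  two roles: an operator on one qubit, or the coefficients of a two-qubit vector, with rows for A
  and columns for B.\<close>

type_synonym cmat = "complex^bool^bool"

definition dag :: "cmat \<Rightarrow> cmat" where "dag A = (\<chi> i j. cnj (A $ j $ i))"
definition msc :: "complex \<Rightarrow> cmat \<Rightarrow> cmat" where "msc c A = (\<chi> i j. c * A $ i $ j)"
definition det2 :: "cmat \<Rightarrow> complex" where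
  "det2 A = A $ False $ False * A $ True $ True - A $ False $ True * A $ True $ False"

definition adj2 :: "cmat \<Rightarrow> cmat" where
  "adj2 A = (\<chi> i j. if i = j then A $ (\<not> i) $ (\<not> i) else - A $ i $ j)"

definition tr2 :: "cmat \<Rightarrow> complex" where "tr2 A = A $ False $ False + A $ True $ True"
text \<open>The symmetric bilinear form with \<open>polar A A = 2 * det2 A\<close>. On two-qubit
  vectors it is, up to sign, the spin-flip form that defines the concurrence.\<close>

definition polar :: "cmat \<Rightarrow> cmat \<Rightarrow> complex" where
  "polar A B = A $ False $ False * B $ True $ True + B $ False $ False * A $ True $ True
     - A $ False $ True * B $ True $ False - B $ False $ True * A $ True $ False"

lemma cmat_eq_iff:
  "(A :: cmat) = B \<longleftrightarrow> A $ False $ False = B $ False $ False \<and> A $ False $ True = B $ False $ True \<and>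
     A $ True $ False = B $ True $ False \<and> A $ True $ True = B $ True $ True"
  by (auto simp: vec_eq_iff all_bool_eq)

lemma cmat_mult_nth: "((A :: cmat) ** B) $ i $ j = A $ i $ False * B $ False $ j + A $ i $ True * B $ True $ j"
  by (simp add: matrix_matrix_mult_def UNIV_bool)

lemma cmat_one_nth: "(mat 1 :: cmat) $ i $ j = (if i = j then 1 else 0)"
  by (simp add: mat_def)

lemma dag_nth: "dag A $ i $ j = cnj (A $ j $ i)" by (simp add: dag_def)
lemma msc_nth: "msc c A $ i $ j = c * A $ i $ j" by (simp add: msc_def)
lemma adj2_nth: "adj2 A $ i $ j = (if i = j then A $ (\<not> i) $ (\<not> i) else - A $ i $ j)" by (simp add: adj2_def)

lemmas cmat_simps = cmat_eq_iff cmat_mult_nth cmat_one_nth dag_nth msc_nth adj2_nth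

lemma dag_mult: "dag (A ** B) = dag B ** dag A" by (simp add: cmat_simps)
lemma dag_dag [simp]: "dag (dag A) = A" by (simp add: cmat_simps)
lemma dag_add: "dag (A + B) = dag A + dag B" by (simp add: cmat_simps)
lemma dag_one [simp]: "dag (mat 1) = mat 1" by (simp add: cmat_simps)
lemma dag_msc: "dag (msc c A) = msc (cnj c) (dag A)" by (simp add: cmat_simps)
lemma msc_mult_left: "msc c A ** B = msc c (A ** B)" by (simp add: cmat_simps algebra_simps)
lemma msc_mult_right: "A ** msc c B = msc c (A ** B)" by (simp add: cmat_simps algebra_simps)
lemma msc_msc: "msc c (msc d A) = msc (c * d) A" by (simp add: cmat_simps)
lemma msc_one [simp]: "msc 1 A = A" by (simp add: cmat_simps)
lemma msc_add: "msc c (A + B) = msc c A + msc c B" by (simp add: cmat_simps algebra_simps)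
lemma cmat_add_mult: "((A :: cmat) + B) ** C = A ** C + B ** C"
  by (simp add: matrix_matrix_mult_def vec_eq_iff sum.distrib distrib_right)

lemma cmat_mult_add: "(A :: cmat) ** (B + C) = A ** B + A ** C" by (rule matrix_add_ldistrib)
lemma det2_mult: "det2 (A ** B) = det2 A * det2 B" by (simp add: det2_def cmat_simps) algebra
lemma det2_msc: "det2 (msc c A) = c\<^sup>2 * det2 A" by (simp add: det2_def msc_nth) algebra
lemma det2_dag: "det2 (dag A) = cnj (det2 A)" by (simp add: det2_def dag_nth algebra_simps)
lemma det2_adj2: "det2 (adj2 A) = det2 A" by (simp add: det2_def adj2_nth algebra_simps)
lemma adj2_adj2 [simp]: "adj2 (adj2 A) = A" by (simp add: cmat_simps)
lemma mult_adj2: "A ** adj2 A = msc (det2 A) (mat 1)" by (simp add: det2_def cmat_simps algebra_simps)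
lemma det2_lincomb: "det2 (msc x A + msc y B) = x\<^sup>2 * det2 A + y\<^sup>2 * det2 B + x * y * polar A B"
  by (simp add: det2_def polar_def msc_nth) algebra

lemma polar_mult_left: "polar (A ** B) (A ** C) = det2 A * polar B C"
  by (simp add: det2_def polar_def cmat_mult_nth) algebra

lemma polar_msc: "polar (msc c A) (msc d B) = c * d * polar A B"
  by (simp add: polar_def msc_nth) algebra

text \<open>Cayley-Hamilton; \<open>traceless_anticomm\<close> is its polarised form. With
  determinant one and vanishing \<open>polar\<close> they become the relations of quaternion
  units.\<close>

lemma traceless_sq:
  assumes "tr2 A = 0" shows "A ** A = msc (- det2 A) (mat 1)"
proof -
  have "A $ True $ True = - A $ False $ False" using assms by (simp add: tr2_def add_eq_0_iff)
  then show ?thesis by (simp add: cmat_simps det2_def algebra_simps)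
qed

lemma traceless_anticomm:
  assumes "tr2 A = 0" "tr2 B = 0"
  shows "A ** B = msc (- 1) (B ** A) + msc (- polar A B) (mat 1)"
proof -
  have "A $ True $ True = - A $ False $ False" "B $ True $ True = - B $ False $ False"
    using assms by (simp_all add: tr2_def add_eq_0_iff)
  then show ?thesis by (simp add: cmat_simps polar_def algebra_simps)
qed

lemma cmat_assoc: "((A :: cmat) ** B) ** C = A ** (B ** C)"
  by (simp add: matrix_mul_assoc)

lemma anticomm_left: "A ** B = msc (-1) (B ** A) \<Longrightarrow> A ** (B ** X) = msc (-1) (B ** (A ** X))"
  by (metis cmat_assoc msc_mult_left)

lemma square_left: "A ** A = msc c (mat 1) \<Longrightarrow> A ** (A ** X) = msc c X"
  by (metis cmat_assoc msc_mult_left matrix_mul_lid)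

section \<open>Real powers and weighted sums\<close>

text \<open>The sign of the derivative in \<open>s\<close> is that of
  \<open>p powr x - (1 + s) powr (x - 1)\<close>. This is nonnegative because (1+s)^(x-1) <= 2^(x-1)
  <= 2^(-x) <= p^x, where the middle step uses x <= 1/2 and the last one 1/2 <= p.\<close>

lemma powr_ratio_mono:
  fixes x p k t :: real
  assumes x: "0 \<le> x" "x \<le> 1/2" and p: "1/2 \<le> p" and k: "1 \<le> k" and kt: "k \<le> t"
  shows "((1 + k) powr x - p powr x) * k powr (- x) \<le> ((1 + t) powr x - p powr x) * t powr (- x)"
proof (rule DERIV_nonneg_imp_nondecreasing[OF kt])
  fix s assume "k \<le> s" "s \<le> t"
  then have s: "1 \<le> s" using k by simp
  have "((\<lambda>s. ((1 + s) powr x - p powr x) * s powr (- x)) has_real_derivative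
      (x * (1 + s) powr (x - 1)) * s powr (- x) + ((1 + s) powr x - p powr x) * (- x * s powr (- x - 1))) (at s)"
    using s by (auto intro!: derivative_eq_intros)
  moreover have "(x * (1 + s) powr (x - 1)) * s powr (- x) + ((1 + s) powr x - p powr x) * (- x * s powr (- x - 1))
      = x * s powr (- x - 1) * (p powr x - (1 + s) powr (x - 1))"
  proof -
    have "s powr (- x) = s * s powr (- x - 1)" using s powr_mult_base[of s "- x - 1"] by simp
    moreover have "(1 + s) powr x = (1 + s) * (1 + s) powr (x - 1)" using s powr_mult_base[of "1 + s" "x - 1"] by simp
    ultimately show ?thesis by (simp only:) (simp add: algebra_simps)
  qed
  moreover have "(1 + s) powr (x - 1) \<le> p powr x"
  proof -
    have "(1 + s) powr (x - 1) \<le> 2 powr (x - 1)" using s x by (intro powr_mono2') auto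
    also have "\<dots> \<le> 2 powr (- x)" using x by (intro powr_mono) auto
    also have "\<dots> = (1/2) powr x" by (simp add: powr_minus_divide powr_divide)
    also have "\<dots> \<le> p powr x" using p x by (intro powr_mono2) auto
    finally show ?thesis .
  qed
  ultimately show "\<exists>y. ((\<lambda>s. ((1 + s) powr x - p powr x) * s powr (- x)) has_real_derivative y) (at s) \<and> 0 \<le> y"
    using x by (intro exI[of _ "x * s powr (- x - 1) * (p powr x - (1 + s) powr (x - 1))"]) auto
qed

text \<open>Serves the case \<open>b = 0\<close> of \<open>powr_split\<close>, where the ratio is
  infinite. Since (1+1/k)^x <= sqrt(1+1/k) <= 1+1/(2k), the power (1+k)^x exceeds k^x by at most
  k^x/(2k) <= 1/2 <= p^x.\<close>

lemma powr_ratio_le_one: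
  fixes x p k :: real
  assumes x: "0 \<le> x" "x \<le> 1/2" and p: "1/2 \<le> p" "p \<le> 1" and k: "1 \<le> k"
  shows "((1 + k) powr x - p powr x) / k powr x \<le> 1"
proof -
  have "(1 + 1 / k) powr x \<le> (1 + 1 / k) powr (1/2)" using x k by (intro powr_mono) auto
  also have "\<dots> = sqrt (1 + 1 / k)" using k by (simp add: powr_half_sqrt)
  also have "\<dots> \<le> 1 + 1 / (2 * k)"
    using k by (intro real_le_lsqrt) (auto simp: power2_sum power2_eq_square field_simps)
  finally have "k powr x * (1 + 1 / k) powr x \<le> k powr x * (1 + 1 / (2 * k))" by (intro mult_left_mono) auto
  also have "k powr x * (1 + 1 / k) powr x = (1 + k) powr x"
    using k by (simp add: powr_mult[symmetric] distrib_left add.commute)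
  also have "k powr x * (1 + 1 / (2 * k)) \<le> k powr x + 1/2"
  proof -
    have "k powr x \<le> k powr 1" using x k by (intro powr_mono) auto
    then show ?thesis using k by (simp add: field_simps)
  qed
  also have "1/2 \<le> p powr x"
  proof -
    have "p powr 1 \<le> p powr x" using x p by (intro powr_mono') auto
    then show ?thesis using p by simp
  qed
  finally show ?thesis using k by (simp add: divide_simps)
qed

text \<open>Dividing by \<open>b powr x\<close> reduces the claim to the monotonicity of ((1+t)^x -
  p^x)/t^x at \<open>t = a / b\<close>. For \<open>b = 0\<close> the first summand is zero, since
  \<open>0 powr x = 0\<close> even for \<open>x = 0\<close>, and a coefficient of at most one
  suffices for the second.\<close>

lemma powr_split:
  fixes a b c k p x :: real
  assumes x: "0 \<le> x" "x \<le> 1/2" and p: "1/2 \<le> p" "p \<le> 1" and k: "1 \<le> k"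
    and ab: "0 \<le> a" "0 \<le> b" "k * b \<le> a" "a + b \<le> c"
  shows "p powr x * b powr x + ((1 + k) powr x - p powr x) / k powr x * a powr x \<le> c powr x"
proof (cases "b = 0")
  case True
  have "((1 + k) powr x - p powr x) / k powr x * a powr x \<le> 1 * a powr x"
    using powr_ratio_le_one[OF x p k] by (intro mult_right_mono) auto
  also have "\<dots> \<le> c powr x" using ab x True by (simp add: powr_mono2)
  finally show ?thesis using True by simp
next
  case False
  then have b: "b > 0" using ab by simp
  define t where "t = a / b"
  have t: "k \<le> t" using b ab by (simp add: t_def field_simps)
  have a: "a = t * b" using b by (simp add: t_def)
  have "((1 + k) powr x - p powr x) / k powr x \<le> ((1 + t) powr x - p powr x) / t powr x"
    using powr_ratio_mono[OF x p(1) k t] by (simp add: powr_minus_divide)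
  then have "((1 + k) powr x - p powr x) / k powr x * t powr x \<le> (1 + t) powr x - p powr x"
    using t k by (simp add: pos_le_divide_eq)
  then have "(p powr x + ((1 + k) powr x - p powr x) / k powr x * t powr x) * b powr x \<le> (1 + t) powr x * b powr x"
    by (intro mult_right_mono) auto
  also have "\<dots> = (a + b) powr x" using t k b by (simp add: powr_mult[symmetric] a algebra_simps)
  also have "\<dots> \<le> c powr x" using ab x by (intro powr_mono2) auto
  finally show ?thesis using t k b by (simp add: a powr_mult algebra_simps)
qed

text \<open>After division by \<open>Z\<close> both quotients lie in [0,1], where raising the
  exponent from 2 to \<open>r\<close> can only decrease the value.\<close>

lemma powr_add_le_of_squares:
  fixes X Y Z r :: real
  assumes nn: "0 \<le> X" "0 \<le> Y" "0 \<le> Z" and sq: "X\<^sup>2 + Y\<^sup>2 \<le> Z\<^sup>2" and r: "2 \<le> r"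
  shows "X powr r + Y powr r \<le> Z powr r"
proof (cases "Z = 0")
  case True
  then have "X = 0" "Y = 0" using sq by (simp_all add: sum_power2_le_zero_iff)
  then show ?thesis by simp
next
  case False
  then have Z: "Z > 0" using nn by simp
  have le: "W powr r \<le> Z powr r * (W\<^sup>2 / Z\<^sup>2)" if "0 \<le> W" "W\<^sup>2 \<le> Z\<^sup>2" for W
  proof (cases "W = 0")
    case False
    then have W: "W > 0" using that by simp
    have "W \<le> Z" by (rule power2_le_imp_le[OF that(2) nn(3)])
    then have "(W / Z) powr r \<le> (W / Z) powr 2" using W Z r by (intro powr_mono') auto
    also have "(W / Z) powr 2 = W\<^sup>2 / Z\<^sup>2" using W Z by (simp add: power_divide)
    finally show ?thesis using W Z by (simp add: powr_divide pos_divide_le_eq mult.commute)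
  qed simp
  have "X powr r + Y powr r \<le> Z powr r * (X\<^sup>2 / Z\<^sup>2) + Z powr r * (Y\<^sup>2 / Z\<^sup>2)"
    using sq nn zero_le_power2[of X] zero_le_power2[of Y] by (intro add_mono le) linarith+
  also have "\<dots> = Z powr r * ((X\<^sup>2 + Y\<^sup>2) / Z\<^sup>2)" by (simp add: add_divide_distrib distrib_left)
  also have "\<dots> \<le> Z powr r * 1" using sq Z by (intro mult_left_mono) auto
  finally show ?thesis by simp
qed

section \<open>Telescoping one-step inequalities into weighted sums\<close>

text \<open>Each step trades \<open>Q (i - 1)\<close> for \<open>P i\<close> with weight
  \<open>c\<close> and \<open>Q i\<close> with weight \<open>l\<close>, so the term at
  \<open>i\<close> has collected i - 2 factors \<open>l\<close>. At the base \<open>m = 1\<close>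
  the sum is empty.\<close>

lemma chain_first:
  fixes P Q :: "nat \<Rightarrow> real"
  assumes "0 \<le> l" "1 \<le> m" "\<And>i. 2 \<le> i \<Longrightarrow> i \<le> m \<Longrightarrow> c * P i + l * Q i \<le> Q (i - 1)"
  shows "c * (\<Sum>i=2..m. l ^ (i - 2) * P i) + l ^ (m - 1) * Q m \<le> Q 1"
  using assms(2,3)
proof (induction m rule: dec_induct)
  case (step m)
  have IH: "c * (\<Sum>i=2..m. l ^ (i - 2) * P i) + l ^ (m - 1) * Q m \<le> Q 1"
    by (rule step.IH) (rule step.prems; simp)
  have "c * P (Suc m) + l * Q (Suc m) \<le> Q m" using step.prems[of "Suc m"] step.hyps by simp
  then have H: "l ^ (m - 1) * (c * P (Suc m) + l * Q (Suc m)) \<le> l ^ (m - 1) * Q m"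
    using assms(1) by (intro mult_left_mono) auto
  have E: "l ^ (m - 1) * (c * P (Suc m) + l * Q (Suc m)) = c * (l ^ (m - 1) * P (Suc m)) + l ^ m * Q (Suc m)"
  proof -
    have "l ^ m = l ^ (m - 1) * l" using step.hyps by (simp flip: power_Suc2)
    then show ?thesis by (simp only:) (simp add: algebra_simps)
  qed
  have "(\<Sum>i=2..Suc m. l ^ (i - 2) * P i) = (\<Sum>i=2..m. l ^ (i - 2) * P i) + l ^ (m - 1) * P (Suc m)"
    using step.hyps by (simp add: numeral_2_eq_2)
  then show ?case using IH H unfolding E by (simp add: distrib_left)
qed simp

text \<open>Here \<open>P i\<close> takes \<open>l\<close> and the factor passed on is
  \<open>c\<close>. The free starting point \<open>s\<close> lets this chain be appended to
  \<open>chain_first\<close> at \<open>s = m\<close> or start on its own at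
  \<open>s = 1\<close>.\<close>

lemma chain_second:
  fixes P Q :: "nat \<Rightarrow> real"
  assumes "0 \<le> c" "s \<le> m" "\<And>i. s < i \<Longrightarrow> i \<le> m \<Longrightarrow> l * P i + c * Q i \<le> Q (i - 1)"
  shows "l * (\<Sum>i=s+1..m. c ^ (i - s - 1) * P i) + c ^ (m - s) * Q m \<le> Q s"
  using assms(2,3)
proof (induction m rule: dec_induct)
  case (step m)
  have IH: "l * (\<Sum>i=s+1..m. c ^ (i - s - 1) * P i) + c ^ (m - s) * Q m \<le> Q s"
    by (rule step.IH) (rule step.prems; simp)
  have "l * P (Suc m) + c * Q (Suc m) \<le> Q m" using step.prems[of "Suc m"] step.hyps by simp
  then have "c ^ (m - s) * (l * P (Suc m) + c * Q (Suc m)) \<le> c ^ (m - s) * Q m"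
    using assms(1) by (intro mult_left_mono) auto
  then show ?case using IH step.hyps by (simp add: Suc_diff_le algebra_simps)
qed simp

text \<open>The triangle inequality for the plane vectors (a x, b x). It carries the bound on
  squares from pure components to a whole ensemble.\<close>

lemma minkowski_list:
  fixes a b c :: "'a \<Rightarrow> real"
  assumes "\<And>x. x \<in> set xs \<Longrightarrow> (a x)\<^sup>2 + (b x)\<^sup>2 \<le> (c x)\<^sup>2" "\<And>x. x \<in> set xs \<Longrightarrow> 0 \<le> c x"
  shows "sqrt ((\<Sum>x\<leftarrow>xs. a x)\<^sup>2 + (\<Sum>x\<leftarrow>xs. b x)\<^sup>2) \<le> (\<Sum>x\<leftarrow>xs. c x)"
  using assms
proof (induction xs)
  case (Cons x xs)
  have "sqrt ((a x)\<^sup>2 + (b x)\<^sup>2) \<le> c x" using Cons.prems by (intro real_le_lsqrt) auto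
  moreover have "sqrt ((\<Sum>x\<leftarrow>xs. a x)\<^sup>2 + (\<Sum>x\<leftarrow>xs. b x)\<^sup>2) \<le> (\<Sum>x\<leftarrow>xs. c x)" using Cons by auto
  moreover have "sqrt ((a x + (\<Sum>x\<leftarrow>xs. a x))\<^sup>2 + (b x + (\<Sum>x\<leftarrow>xs. b x))\<^sup>2)
      \<le> sqrt ((a x)\<^sup>2 + (b x)\<^sup>2) + sqrt ((\<Sum>x\<leftarrow>xs. a x)\<^sup>2 + (\<Sum>x\<leftarrow>xs. b x)\<^sup>2)"
    by (rule real_sqrt_sum_squares_triangle_ineq)
  ultimately show ?case by simp
qed simp

lemma weighted_sum_bounds:
  fixes P Q :: "nat \<Rightarrow> real"
  assumes n3: "3 \<le> n" and l0: "0 \<le> l" and c0: "0 \<le> c" and last: "Q (n - 1) = P n"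
    and first: "\<And>i. 2 \<le> i \<Longrightarrow> i \<le> n - 1 \<Longrightarrow> A i \<Longrightarrow> c * P i + l * Q i \<le> Q (i - 1)"
    and second: "\<And>i. 2 \<le> i \<Longrightarrow> i \<le> n - 1 \<Longrightarrow> B i \<Longrightarrow> l * P i + c * Q i \<le> Q (i - 1)"
  shows "2 \<le> m \<Longrightarrow> m \<le> n - 2 \<Longrightarrow> \<forall>i\<in>{2..m}. A i \<Longrightarrow> \<forall>j\<in>{m+1..n-1}. B j \<Longrightarrow>
      c * (\<Sum>i=2..m. l ^ (i - 2) * P i) + l ^ m * (\<Sum>i=m+1..n-1. c ^ (i - m - 1) * P i)
      + l ^ (m - 1) * c ^ (n - m - 1) * P n \<le> Q 1"
    and "\<forall>i\<in>{2..n-1}. A i \<Longrightarrow> c * (\<Sum>i=2..n-1. l ^ (i - 2) * P i) + l ^ (n - 2) * P n \<le> Q 1"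
    and "\<forall>j\<in>{2..n-1}. B j \<Longrightarrow> l * (\<Sum>i=2..n-1. c ^ (i - 2) * P i) + c ^ (n - 2) * P n \<le> Q 1"
proof -
  show "c * (\<Sum>i=2..m. l ^ (i - 2) * P i) + l ^ m * (\<Sum>i=m+1..n-1. c ^ (i - m - 1) * P i)
      + l ^ (m - 1) * c ^ (n - m - 1) * P n \<le> Q 1"
    if "2 \<le> m" "m \<le> n - 2" "\<forall>i\<in>{2..m}. A i"
      "\<forall>j\<in>{m+1..n-1}. B j"
  proof -
    have "c * (\<Sum>i=2..m. l ^ (i - 2) * P i) + l ^ (m - 1) * Q m \<le> Q 1"
      using that n3 by (intro chain_first l0 first) auto
    \<comment> \<open>The first chain carries \<open>Q m\<close> with weight
      \<open>l ^ (m - 1)\<close>. The leading \<open>l\<close> of the second chain completes this to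
      \<open>l ^ m\<close>, except at the final term \<open>P n\<close>, which lacks that
      factor.\<close>
    moreover have "l * (\<Sum>i=m+1..n-1. c ^ (i - m - 1) * P i) + c ^ (n - 1 - m) * Q (n - 1) \<le> Q m"
      using that n3 by (intro chain_second c0 second) auto
    then have "l ^ (m - 1) * (l * (\<Sum>i=m+1..n-1. c ^ (i - m - 1) * P i) + c ^ (n - 1 - m) * Q (n - 1)) \<le> l ^ (m - 1) * Q m"
      using l0 by (intro mult_left_mono) auto
    then have "(l ^ (m - 1) * l) * (\<Sum>i=m+1..n-1. c ^ (i - m - 1) * P i) + l ^ (m - 1) * c ^ (n - 1 - m) * P n \<le> l ^ (m - 1) * Q m"
      by (simp only: last distrib_left mult.assoc)
    moreover have "l ^ (m - 1) * l = l ^ m" using that by (simp flip: power_Suc2)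
    moreover have "n - 1 - m = n - m - 1" by simp
    ultimately show ?thesis by simp
  qed
  show "c * (\<Sum>i=2..n-1. l ^ (i - 2) * P i) + l ^ (n - 2) * P n \<le> Q 1"
    if "\<forall>i\<in>{2..n-1}. A i"
  proof -
    have "c * (\<Sum>i=2..n-1. l ^ (i - 2) * P i) + l ^ (n - 1 - 1) * Q (n - 1) \<le> Q 1"
      using that n3 by (intro chain_first l0 first) auto
    moreover have "n - 1 - 1 = n - 2" by simp
    ultimately show ?thesis unfolding last by simp
  qed
  show "l * (\<Sum>i=2..n-1. c ^ (i - 2) * P i) + c ^ (n - 2) * P n \<le> Q 1"
    if "\<forall>j\<in>{2..n-1}. B j"
  proof -
    have "l * (\<Sum>i=1+1..n-1. c ^ (i - 1 - 1) * P i) + c ^ (n - 1 - 1) * Q (n - 1) \<le> Q 1"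
      using that n3 by (intro chain_second c0 second) auto
    moreover have "n - 1 - 1 = n - 2" "\<And>i. i - 1 - 1 = i - (2::nat)" "1 + 1 = (2::nat)" by simp_all
    ultimately show ?thesis unfolding last by (simp only:)
  qed
qed

section \<open>Concurrence in terms of unnormalised vectors\<close>

text \<open>Turns extremality into first-order conditions: an affine function bounded above on the
  whole line has no slope.\<close>

lemma linear_bounded_above_zero:
  fixes A B :: real
  assumes "\<And>x. A + B * x \<le> 0"
  shows "B = 0"
proof (rule ccontr)
  assume "B \<noteq> 0"
  then have "A + B * ((1 - A) / B) = 1" by simp
  with assms[of "(1 - A) / B"] show False by simp
qed

lemma cnj_mult_self: "cnj z * z = of_real ((cmod z)\<^sup>2)"
  by (metis complex_norm_square mult.commute)

text \<open>Gaussian elimination: column \<open>a\<close> divided by the root of its diagonal entry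
  is one vector, and the Schur complement on \<open>F\<close> is again positive semidefinite. The
  exact length matters later, when a two-qubit operator must get four vectors.\<close>

lemma cholesky:
  fixes \<rho> :: "'i \<Rightarrow> 'i \<Rightarrow> complex"
  assumes "finite I"
    and "\<And>x y. x \<in> I \<Longrightarrow> y \<in> I \<Longrightarrow> \<rho> x y = cnj (\<rho> y x)"
    and "\<And>v. 0 \<le> Re (\<Sum>x\<in>I. \<Sum>y\<in>I. cnj (v x) * \<rho> x y * v y)"
  shows "\<exists>vs. length vs = card I \<and> (\<forall>x\<in>I. \<forall>y\<in>I. \<rho> x y = (\<Sum>v\<leftarrow>vs. v x * cnj (v y)))"
  using assms
proof (induction I arbitrary: \<rho> rule: finite_induct)
  case empty
  show ?case by simp
next
  case (insert a F)
  define r where "r = Re (\<rho> a a)"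
  have aa: "\<rho> a a = of_real r" using insert.prems(1)[of a a] by (simp add: r_def complex_eq_iff)
  have herm: "\<rho> x y = cnj (\<rho> y x)" if "x \<in> insert a F" "y \<in> insert a F" for x y
    using insert.prems(1) that by blast
  define B where "B v = (\<Sum>y\<in>F. \<rho> a y * v y)" for v
  define Q where "Q v = (\<Sum>x\<in>F. \<Sum>y\<in>F. cnj (v x) * \<rho> x y * v y)" for v
  have cB: "(\<Sum>x\<in>F. cnj (v x) * \<rho> x a) = cnj (B v)" for v
    unfolding B_def cnj_sum by (rule sum.cong) (use herm[of _ a] in auto)
  \<comment> \<open>The form at \<open>v\<close> with the value \<open>c\<close> placed in slot
    \<open>a\<close>; suitable choices of \<open>c\<close> yield everything below.\<close>
  have pos: "0 \<le> r * (cmod c)\<^sup>2 + 2 * Re (cnj c * B v) + Re (Q v)" for v c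
  proof -
    let ?v = "v(a := c)"
    have v: "?v x = v x" if "x \<in> F" for x using that insert.hyps by auto
    have "(\<Sum>x\<in>insert a F. \<Sum>y\<in>insert a F. cnj (?v x) * \<rho> x y * ?v y)
      = cnj c * \<rho> a a * c + cnj c * B v + (\<Sum>x\<in>F. cnj (v x) * \<rho> x a) * c + Q v"
      using insert.hyps v by (simp add: sum.distrib B_def Q_def sum_distrib_left sum_distrib_right mult.assoc)
    moreover have "cnj c * \<rho> a a * c = of_real (r * (cmod c)\<^sup>2)"
      using complex_norm_square[of c] by (simp add: aa)
    moreover have "Re (cnj (B v) * c) = Re (cnj c * B v)" by simp
    ultimately show ?thesis using insert.prems(2)[of ?v] unfolding cB by simp
  qed
  have r0: "r \<ge> 0"
  proof -
    have "B (\<lambda>_. 0) = 0" "Q (\<lambda>_. 0) = 0" by (simp_all add: B_def Q_def)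
    then show ?thesis using pos[of 1 "\<lambda>_. 0"] by simp
  qed
  \<comment> \<open>The Schur complement. For \<open>r = 0\<close> division by zero gives 0, so the
    correction and \<open>v0\<close> both vanish.\<close>
  define \<rho>' where "\<rho>' x y = \<rho> x y - \<rho> x a * \<rho> a y / r" for x y
  define v0 where "v0 x = \<rho> x a / sqrt r" for x
  have zero: "\<rho> a y = 0" if "r = 0" "y \<in> F" for y
  proof -
    define v where "v = (\<lambda>x. if x = y then 1 else 0 :: complex)"
    have B: "B v = \<rho> a y" using that insert.hyps by (simp add: B_def v_def if_distrib[of "(*) _"] cong: if_cong)
    \<comment> \<open>With \<open>c = - t * \<rho> a y\<close> the quadratic term has coefficient
      \<open>r = 0\<close>, so the form is affine in \<open>t\<close> and its slope must
      vanish.\<close>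
    have "- Re (Q v) + 2 * (cmod (\<rho> a y))\<^sup>2 * t \<le> 0" for t :: real
    proof -
      have "cnj (of_real (- t) * \<rho> a y) * \<rho> a y = of_real (- t * (cmod (\<rho> a y))\<^sup>2)"
        using cnj_mult_self[of "\<rho> a y"] by (simp add: mult.assoc)
      then have e: "Re (cnj (of_real (- t) * \<rho> a y) * \<rho> a y) = - t * (cmod (\<rho> a y))\<^sup>2"
        by (simp only: Re_complex_of_real)
      show ?thesis using pos[of "of_real (- t) * \<rho> a y" v] unfolding B e that(1) by (simp add: mult_ac)
    qed
    from linear_bounded_above_zero[OF this] show ?thesis by simp
  qed
  have "\<exists>vs. length vs = card F \<and> (\<forall>x\<in>F. \<forall>y\<in>F. \<rho>' x y = (\<Sum>v\<leftarrow>vs. v x * cnj (v y)))"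
  proof (rule insert.IH)
    show "\<rho>' x y = cnj (\<rho>' y x)" if "x \<in> F" "y \<in> F" for x y
      using herm[of x y] herm[of x a] herm[of a y] that by (simp add: \<rho>'_def)
    fix v
    have "(\<Sum>x\<in>F. \<Sum>y\<in>F. cnj (v x) * \<rho>' x y * v y)
        = Q v - (\<Sum>x\<in>F. \<Sum>y\<in>F. (cnj (v x) * \<rho> x a) * (\<rho> a y * v y)) / r"
      by (simp add: Q_def \<rho>'_def algebra_simps sum_subtractf sum_divide_distrib)
    also have "(\<Sum>x\<in>F. \<Sum>y\<in>F. (cnj (v x) * \<rho> x a) * (\<rho> a y * v y)) = of_real ((cmod (B v))\<^sup>2)"
      unfolding sum_product[symmetric] cB complex_norm_square by (simp add: B_def)
    finally have eq: "Re (\<Sum>x\<in>F. \<Sum>y\<in>F. cnj (v x) * \<rho>' x y * v y) = Re (Q v) - (cmod (B v))\<^sup>2 / r"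
      by (simp flip: of_real_divide)
    show "0 \<le> Re (\<Sum>x\<in>F. \<Sum>y\<in>F. cnj (v x) * \<rho>' x y * v y)"
    proof (cases "r = 0")
      case True
      then show ?thesis using pos[of 0 v] eq by simp
    next
      case False
      \<comment> \<open>The minimising choice \<open>c = - B v / r\<close> completes the
        square.\<close>
      have "cnj (- B v / r) * B v = of_real (- (cmod (B v))\<^sup>2 / r)"
        using cnj_mult_self[of "B v"] by simp
      then have "Re (cnj (- B v / r) * B v) = - (cmod (B v))\<^sup>2 / r"
        by (simp only: Re_complex_of_real)
      moreover have "r * (cmod (- B v / r))\<^sup>2 = (cmod (B v))\<^sup>2 / r"
        using False by (simp add: norm_divide power_divide power2_eq_square)
      ultimately show ?thesis unfolding eq using pos[of "- B v / r" v] by linarith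
    qed
  qed
  then obtain vs where len: "length vs = card F"
    and vs: "\<And>x y. x \<in> F \<Longrightarrow> y \<in> F \<Longrightarrow> \<rho>' x y = (\<Sum>v\<leftarrow>vs. v x * cnj (v y))" by blast
  let ?vs = "v0 # map (\<lambda>v. v(a := 0)) vs"
  have sqr: "complex_of_real (sqrt r) * complex_of_real (sqrt r) = of_real r"
    using r0 by (simp flip: of_real_mult)
  have v00: "v0 x * cnj (v0 y) = \<rho> x a * \<rho> a y / r" if "x \<in> insert a F" "y \<in> insert a F" for x y
    using herm[of a y] that by (simp add: v0_def sqr)
  have "\<rho> x y = (\<Sum>v\<leftarrow>?vs. v x * cnj (v y))" if xy: "x \<in> insert a F" "y \<in> insert a F" for x y
  proof (cases "x = a \<or> y = a")
    case True
    then have "(\<Sum>v\<leftarrow>map (\<lambda>v. v(a := 0)) vs. v x * cnj (v y)) = 0"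
      by (induction vs) auto
    moreover have "\<rho> x a * \<rho> a y / r = \<rho> x y"
    proof (cases "r = 0")
      case r: True
      have row: "\<rho> a z = 0" if "z \<in> insert a F" for z using zero[OF r] aa r that by auto
      have "\<rho> z a = 0" if "z \<in> insert a F" for z by (subst herm) (use row that in auto)
      then have "\<rho> x y = 0" using True row xy by blast
      then show ?thesis using r by simp
    next
      case False
      then show ?thesis using True aa by auto
    qed
    ultimately show ?thesis using v00[OF xy] by simp
  next
    case False
    then have "(\<Sum>v\<leftarrow>map (\<lambda>v. v(a := 0)) vs. v x * cnj (v y)) = \<rho>' x y"
      using vs xy by (auto simp: comp_def)
    then show ?thesis using v00[OF xy] by (simp add: \<rho>'_def)
  qed
  then show ?case using len insert.hyps by (intro exI[of _ ?vs]) simp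
qed

text \<open>The unnormalised reduced state of qubit \<open>0\<close>; \<open>cvec\<close> below is then homogeneous of degree two in
  the vector and equals the concurrence on unit vectors.\<close>
definition gmat :: "nat set \<Rightarrow> ((nat \<Rightarrow> bool) \<Rightarrow> complex) \<Rightarrow> cmat" where
  "gmat Y v = (\<chi> a c. \<Sum>z\<in>configs Y. v (z(0 := a)) * cnj (v (z(0 := c))))"

definition cvec :: "nat set \<Rightarrow> ((nat \<Rightarrow> bool) \<Rightarrow> complex) \<Rightarrow> real" where
  "cvec Y v = 2 * sqrt (Re (det2 (gmat Y v)))"

text \<open>An ensemble with each weight absorbed into its vector as a square root. Without
  normalisation, partial traces and unitary mixing of vectors stay within the notion.\<close>

definition decomp :: "nat set \<Rightarrow> ((nat \<Rightarrow> bool) \<Rightarrow> (nat \<Rightarrow> bool) \<Rightarrow> complex)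
    \<Rightarrow> ((nat \<Rightarrow> bool) \<Rightarrow> complex) list \<Rightarrow> bool" where
  "decomp S \<rho> vs \<longleftrightarrow> (\<forall>x\<in>configs S. \<forall>y\<in>configs S. \<rho> x y = (\<Sum>v\<leftarrow>vs. v x * cnj (v y)))"

section \<open>Sums over configurations and the concurrence of one vector\<close>

lemma finite_configs [simp]:
  assumes "finite S" shows "finite (configs S)"
proof -
  have "configs S \<subseteq> (\<lambda>A i. i \<in> A) ` Pow S"
  proof
    fix x assume "x \<in> configs S"
    then have "{i. x i} \<in> Pow S" "x = (\<lambda>i. i \<in> {i. x i})" by (auto simp: configs_def)
    then show "x \<in> (\<lambda>A i. i \<in> A) ` Pow S" by blast
  qed
  then show ?thesis using assms by (meson finite_Pow_iff finite_imageI finite_subset)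
qed

lemma configs_empty: "configs {} = {\<lambda>_. False}"
  by (auto simp: configs_def)

lemma sum_configs_insert:
  fixes f :: "(nat \<Rightarrow> bool) \<Rightarrow> 'a::comm_monoid_add"
  assumes "i \<notin> Y" "finite Y"
  shows "(\<Sum>x\<in>configs (insert i Y). f x) = (\<Sum>z\<in>configs Y. f (z(i := False))) + (\<Sum>z\<in>configs Y. f (z(i := True)))"
proof -
  have e: "z(i := False) = z" if "z \<in> configs Y" for z
    using that assms by (auto simp: configs_def fun_eq_iff)
  have s: "configs (insert i Y) = configs Y \<union> (\<lambda>z. z(i := True)) ` configs Y"
  proof (intro equalityI subsetI)
    fix x assume x: "x \<in> configs (insert i Y)"
    show "x \<in> configs Y \<union> (\<lambda>z. z(i := True)) ` configs Y"
    proof (cases "x i")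
      case True
      then have "x = (x(i := False))(i := True)" "x(i := False) \<in> configs Y"
        using x by (auto simp: configs_def fun_eq_iff)
      then show ?thesis by blast
    next
      case False
      then show ?thesis using x by (auto simp: configs_def)
    qed
  qed (auto simp: configs_def)
  have inj: "inj_on (\<lambda>z. z(i := True)) (configs Y)"
  proof (rule inj_onI)
    fix y z assume "y \<in> configs Y" "z \<in> configs Y" "y(i := True) = z(i := True)"
    then show "y = z" using e by (metis fun_upd_upd)
  qed
  have disj: "configs Y \<inter> (\<lambda>z. z(i := True)) ` configs Y = {}"
    using assms by (auto simp: configs_def)
  have "(\<Sum>z\<in>configs Y. f (z(i := False))) = (\<Sum>z\<in>configs Y. f z)" by (rule sum.cong) (auto simp: e)
  then show ?thesis unfolding s using assms inj disj by (simp add: sum.union_disjoint sum.reindex)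
qed

lemma sum_configs_single:
  "(\<Sum>x\<in>configs {i}. f x) = f (\<lambda>_. False) + (f ((\<lambda>_. False)(i := True)) :: 'a::comm_monoid_add)"
  using sum_configs_insert[of i "{}" f] by (simp add: configs_empty fun_upd_def)

lemma gmat_nth: "gmat Y v $ a $ c = (\<Sum>z\<in>configs Y. v (z(0 := a)) * cnj (v (z(0 := c))))"
  by (simp add: gmat_def)

lemma gmat_diag: "gmat Y v $ a $ a = of_real (\<Sum>z\<in>configs Y. (cmod (v (z(0 := a))))\<^sup>2)"
  unfolding gmat_nth of_real_sum complex_norm_square ..

lemma gmat_offdiag: "gmat Y v $ a $ c = cnj (gmat Y v $ c $ a)"
  by (simp add: gmat_nth mult.commute)

lemma det2_gmat:
  "det2 (gmat Y v) = of_real ((\<Sum>z\<in>configs Y. (cmod (v (z(0 := False))))\<^sup>2) * (\<Sum>z\<in>configs Y. (cmod (v (z(0 := True))))\<^sup>2)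
     - (cmod (gmat Y v $ False $ True))\<^sup>2)"
  unfolding det2_def gmat_diag gmat_offdiag[of Y v True False] of_real_diff of_real_mult complex_norm_square ..

text \<open>A Gram determinant, hence the Cauchy-Schwarz inequality.\<close>

lemma det2_gmat_nonneg: "0 \<le> Re (det2 (gmat Y v))"
proof -
  have "cmod (gmat Y v $ False $ True) \<le> (\<Sum>z\<in>configs Y. cmod (v (z(0 := False))) * cmod (v (z(0 := True))))"
    unfolding gmat_nth by (rule order.trans[OF norm_sum]) (simp add: norm_mult)
  then have "(cmod (gmat Y v $ False $ True))\<^sup>2 \<le> (\<Sum>z\<in>configs Y. cmod (v (z(0 := False))) * cmod (v (z(0 := True))))\<^sup>2"
    by (intro power_mono) auto
  also have "\<dots> \<le> (\<Sum>z\<in>configs Y. (cmod (v (z(0 := False))))\<^sup>2) * (\<Sum>z\<in>configs Y. (cmod (v (z(0 := True))))\<^sup>2)"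
    by (rule Cauchy_Schwarz_ineq_sum)
  finally show ?thesis unfolding det2_gmat Re_complex_of_real by simp
qed

lemma cvec_nonneg: "0 \<le> cvec Y v"
  using det2_gmat_nonneg by (simp add: cvec_def)

lemma cvec_sq: "(cvec Y v)\<^sup>2 = 4 * Re (det2 (gmat Y v))"
  using det2_gmat_nonneg by (simp add: cvec_def power_mult_distrib)

lemma sqrt_scale:
  assumes "0 \<le> q"
  shows "(complex_of_real (sqrt q) * a) * cnj (complex_of_real (sqrt q) * b) = of_real q * a * cnj b"
proof -
  have "complex_of_real (sqrt q) * complex_of_real (sqrt q) = of_real q"
    using assms by (simp flip: of_real_mult)
  from this[symmetric] show ?thesis by simp
qed

lemma cvec_scale:
  assumes "0 \<le> q" shows "cvec Y (\<lambda>x. of_real (sqrt q) * v x) = q * cvec Y v"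
proof -
  have "gmat Y (\<lambda>x. of_real (sqrt q) * v x) = msc q (gmat Y v)"
    by (simp only: gmat_def msc_def vec_lambda_beta sum_distrib_left sqrt_scale[OF assms]) (simp only: mult.assoc)
  then have "Re (det2 (gmat Y (\<lambda>x. of_real (sqrt q) * v x))) = q\<^sup>2 * Re (det2 (gmat Y v))"
    by (simp add: det2_msc flip: of_real_power)
  then show ?thesis using assms by (simp add: cvec_def real_sqrt_mult)
qed

lemma norm_configs:
  assumes "0 \<notin> Y" "finite Y"
  shows "(\<Sum>x\<in>configs (insert 0 Y). (cmod (v x))\<^sup>2)
    = (\<Sum>z\<in>configs Y. (cmod (v (z(0 := False))))\<^sup>2) + (\<Sum>z\<in>configs Y. (cmod (v (z(0 := True))))\<^sup>2)"
  by (rule sum_configs_insert[OF assms])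

lemma merge_zero:
  assumes "0 \<notin> Y" "x \<in> configs {0}" "z \<in> configs Y"
  shows "merge {0} x z = z(0 := x 0)"
  using assms by (auto simp: merge_def configs_def)

text \<open>A two-by-two matrix of trace one satisfies 1 - tr(\<rho>^2) = 2 det \<rho>.
  Normalisation enters only as \<open>A + B = 1\<close>.\<close>

lemma conc_pure_eq_cvec:
  assumes Y: "0 \<notin> Y" "finite Y" and n: "(\<Sum>x\<in>configs (insert 0 Y). (cmod (\<psi> x))\<^sup>2) = 1"
  shows "conc_pure {0} Y \<psi> = cvec Y \<psi>"
proof -
  define A where "A = (\<Sum>z\<in>configs Y. (cmod (\<psi> (z(0 := False))))\<^sup>2)"
  define B where "B = (\<Sum>z\<in>configs Y. (cmod (\<psi> (z(0 := True))))\<^sup>2)"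
  define r where "r = reduced ({0} \<union> Y) {0} (\<lambda>x y. \<psi> x * cnj (\<psi> y))"
  have AB: "A + B = 1" using n unfolding norm_configs[OF Y] A_def B_def .
  have "({0} \<union> Y) - {0} = Y" using Y by auto
  then have r: "r x y = gmat Y \<psi> $ x 0 $ y 0" if "x \<in> configs {0}" "y \<in> configs {0}" for x y
    unfolding r_def reduced_def gmat_nth
    by (intro sum.cong) (auto simp: merge_zero[OF Y(1)] that)
  have m: "(\<lambda>_. False) \<in> configs {0}" "(\<lambda>_. False)(0 := True) \<in> configs {0}" by (auto simp: configs_def)
  have "(\<Sum>x\<in>configs {0}. \<Sum>y\<in>configs {0}. r x y * r y x) = of_real (A\<^sup>2 + B\<^sup>2 + 2 * (cmod (gmat Y \<psi> $ False $ True))\<^sup>2)"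
  proof -
    have "gmat Y \<psi> $ False $ False = of_real A" "gmat Y \<psi> $ True $ True = of_real B"
      by (simp_all only: gmat_diag A_def B_def)
    then show ?thesis
      unfolding sum_configs_single of_real_add of_real_mult complex_norm_square
      by (simp only: r m) (simp add: gmat_offdiag[of Y \<psi> True False] power2_eq_square)
  qed
  then have "conc_pure {0} Y \<psi> = sqrt (2 * (1 - (A\<^sup>2 + B\<^sup>2 + 2 * (cmod (gmat Y \<psi> $ False $ True))\<^sup>2)))"
    unfolding conc_pure_def Let_def r_def[symmetric] by (simp only: Re_complex_of_real)
  also have "2 * (1 - (A\<^sup>2 + B\<^sup>2 + 2 * (cmod (gmat Y \<psi> $ False $ True))\<^sup>2))
      = 4 * (A * B - (cmod (gmat Y \<psi> $ False $ True))\<^sup>2)"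
  proof -
    have "(A + B)\<^sup>2 = 1" using AB by simp
    then have "A\<^sup>2 + B\<^sup>2 = 1 - 2 * (A * B)" by (simp add: power2_sum)
    then show ?thesis by simp
  qed
  also have "A * B - (cmod (gmat Y \<psi> $ False $ True))\<^sup>2 = Re (det2 (gmat Y \<psi>))"
    unfolding det2_gmat Re_complex_of_real A_def B_def ..
  finally show ?thesis by (simp add: cvec_def real_sqrt_mult)
qed

section \<open>Ensembles versus unnormalised decompositions\<close>

lemma decomp_of_ensemble:
  assumes Y: "0 \<notin> Y" "finite Y" and e: "ensemble (insert 0 Y) \<rho> ens"
  shows "\<exists>vs. decomp (insert 0 Y) \<rho> vs \<and> (\<Sum>(q,\<psi>)\<leftarrow>ens. q * conc_pure {0} Y \<psi>) = (\<Sum>v\<leftarrow>vs. cvec Y v)"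
proof -
  define vs where "vs = map (\<lambda>(q,\<psi>) x. of_real (sqrt q) * \<psi> x) ens"
  have ok: "\<forall>(q,\<psi>)\<in>set ens. 0 \<le> q \<and> (\<Sum>x\<in>configs (insert 0 Y). (cmod (\<psi> x))\<^sup>2) = 1"
    using e by (simp add: ensemble_def)
  have "(\<Sum>(q,\<psi>)\<leftarrow>ens. complex_of_real q * \<psi> x * cnj (\<psi> y)) = (\<Sum>v\<leftarrow>vs. v x * cnj (v y))" for x y
    unfolding vs_def map_map
  proof (intro arg_cong[of _ _ sum_list] map_cong refl)
    fix a assume "a \<in> set ens"
    then have "0 \<le> fst a" using ok by auto
    then show "(case a of (q,\<psi>) \<Rightarrow> complex_of_real q * \<psi> x * cnj (\<psi> y))
      = ((\<lambda>v. v x * cnj (v y)) \<circ> (\<lambda>(q,\<psi>) x. of_real (sqrt q) * \<psi> x)) a"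
      by (simp add: split_def sqrt_scale del: complex_cnj_mult)
  qed
  moreover have "(\<Sum>(q,\<psi>)\<leftarrow>ens. q * conc_pure {0} Y \<psi>) = (\<Sum>v\<leftarrow>vs. cvec Y v)"
    unfolding vs_def map_map
    by (intro arg_cong[of _ _ sum_list] map_cong refl)
       (use ok in \<open>auto simp: cvec_scale conc_pure_eq_cvec[OF Y]\<close>)
  ultimately show ?thesis using e by (intro exI[of _ vs]) (auto simp: decomp_def ensemble_def)
qed

text \<open>Each vector is divided by its norm, whose square becomes the weight. Vectors of norm
  zero are dropped, as they add nothing to the operator or to the sum. The operator itself is left
  unnamed so that induction on the list applies.\<close>

lemma ensemble_of_decomp:
  assumes Y: "0 \<notin> Y" "finite Y"
  shows "\<exists>ens. (\<forall>(q, \<psi>) \<in> set ens. 0 \<le> q \<and> (\<Sum>x\<in>configs (insert 0 Y). (cmod (\<psi> x))\<^sup>2) = 1) \<and>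
     (\<forall>x\<in>configs (insert 0 Y). \<forall>y\<in>configs (insert 0 Y).
        (\<Sum>(q, \<psi>) \<leftarrow> ens. complex_of_real q * \<psi> x * cnj (\<psi> y)) = (\<Sum>v\<leftarrow>vs. v x * cnj (v y))) \<and>
     (\<Sum>(q,\<psi>)\<leftarrow>ens. q * conc_pure {0} Y \<psi>) = (\<Sum>v\<leftarrow>vs. cvec Y v)"
proof (induction vs)
  case Nil
  show ?case by (intro exI[of _ "[]"]) simp
next
  case (Cons v vs)
  let ?S = "configs (insert 0 Y)"
  obtain ens where ens: "\<forall>(q, \<psi>) \<in> set ens. 0 \<le> q \<and> (\<Sum>x\<in>?S. (cmod (\<psi> x))\<^sup>2) = 1"
    "\<forall>x\<in>?S. \<forall>y\<in>?S. (\<Sum>(q, \<psi>) \<leftarrow> ens. complex_of_real q * \<psi> x * cnj (\<psi> y)) = (\<Sum>v\<leftarrow>vs. v x * cnj (v y))"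
    "(\<Sum>(q,\<psi>)\<leftarrow>ens. q * conc_pure {0} Y \<psi>) = (\<Sum>v\<leftarrow>vs. cvec Y v)" using Cons.IH by blast
  define q where "q = (\<Sum>x\<in>?S. (cmod (v x))\<^sup>2)"
  have fin: "finite ?S" using Y by simp
  show ?case
  proof (cases "q = 0")
    case True
    then have v0: "v x = 0" if "x \<in> ?S" for x
      using that fin by (simp add: q_def sum_nonneg_eq_0_iff)
    have "z(0 := a) \<in> ?S" if "z \<in> configs Y" for z a using that by (auto simp: configs_def)
    then have "gmat Y v = 0" using v0 by (simp add: gmat_def vec_eq_iff)
    then have "cvec Y v = 0" by (simp add: cvec_def det2_def)
    then show ?thesis using ens v0 by (intro exI[of _ ens]) simp
  next
    case False
    then have q: "q > 0" using sum_nonneg[of ?S "\<lambda>x. (cmod (v x))\<^sup>2"] by (simp add: q_def)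
    define \<psi> where "\<psi> x = v x / of_real (sqrt q)" for x
    have v: "v = (\<lambda>x. of_real (sqrt q) * \<psi> x)" using q by (simp add: \<psi>_def)
    have n: "(\<Sum>x\<in>?S. (cmod (\<psi> x))\<^sup>2) = 1"
      using q by (simp add: \<psi>_def norm_divide power_divide flip: sum_divide_distrib q_def)
    have "cvec Y v = q * conc_pure {0} Y \<psi>"
      using q unfolding v conc_pure_eq_cvec[OF Y n] by (simp add: cvec_scale)
    moreover have "complex_of_real q * \<psi> x * cnj (\<psi> y) = v x * cnj (v y)" for x y
      unfolding v using q by (simp only: sqrt_scale less_imp_le)
    ultimately show ?thesis using ens q n by (intro exI[of _ "(q,\<psi>) # ens"]) auto
  qed
qed

lemma conc_eq:
  assumes Y: "0 \<notin> Y" "finite Y"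
  shows "conc {0} Y \<rho> = Inf {(\<Sum>v\<leftarrow>vs. cvec Y v) | vs. decomp (insert 0 Y) \<rho> vs}"
proof -
  have "\<exists>ens. ensemble (insert 0 Y) \<rho> ens \<and> (\<Sum>v\<leftarrow>vs. cvec Y v) = (\<Sum>(q,\<psi>)\<leftarrow>ens. q * conc_pure {0} Y \<psi>)"
    if "decomp (insert 0 Y) \<rho> vs" for vs
    using ensemble_of_decomp[OF Y, of vs] that by (fastforce simp: ensemble_def decomp_def)
  then have "{(\<Sum>(q, \<psi>) \<leftarrow> ens. q * conc_pure {0} Y \<psi>) | ens. ensemble (insert 0 Y) \<rho> ens}
     = {(\<Sum>v\<leftarrow>vs. cvec Y v) | vs. decomp (insert 0 Y) \<rho> vs}"
    using decomp_of_ensemble[OF Y] by blast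
  then show ?thesis by (simp add: conc_def)
qed

lemma sum_list_cvec_nonneg: "0 \<le> (\<Sum>v\<leftarrow>vs. cvec Y v)"
  by (induction vs) (auto simp: cvec_nonneg)

lemma conc_le:
  assumes "0 \<notin> Y" "finite Y" "decomp (insert 0 Y) \<rho> vs"
  shows "conc {0} Y \<rho> \<le> (\<Sum>v\<leftarrow>vs. cvec Y v)"
  unfolding conc_eq[OF assms(1,2)]
  by (rule cInf_lower) (use assms(3) in \<open>auto intro!: bdd_belowI[of _ 0] sum_list_cvec_nonneg\<close>)

text \<open>\<open>Inf\<close> of the empty set is unspecified, hence the decomposition assumed as a
  witness.\<close>

lemma conc_greatest:
  assumes "0 \<notin> Y" "finite Y" "decomp (insert 0 Y) \<rho> vs"
    and "\<And>vs. decomp (insert 0 Y) \<rho> vs \<Longrightarrow> c \<le> (\<Sum>v\<leftarrow>vs. cvec Y v)"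
  shows "c \<le> conc {0} Y \<rho>"
  unfolding conc_eq[OF assms(1,2)]
  by (rule cInf_greatest) (use assms(3,4) in auto)

lemma conc_nonneg:
  assumes "0 \<notin> Y" "finite Y" "decomp (insert 0 Y) \<rho> vs"
  shows "0 \<le> conc {0} Y \<rho>"
  by (rule conc_greatest[OF assms sum_list_cvec_nonneg])

section \<open>Partial traces of decompositions\<close>

text \<open>A configuration of \<open>S - U\<close> is a pair of configurations of
  \<open>T - U\<close> and \<open>S - T\<close>, and nested merges agree accordingly.\<close>

lemma reduced_reduced:
  assumes "U \<subseteq> T" "T \<subseteq> S"
  shows "reduced T U (reduced S T \<rho>) = reduced S U \<rho>"
proof (intro ext)
  fix x y
  have m: "merge T (merge U x z) w = merge U x (merge T z w)" for x z w
    using assms by (auto simp: merge_def)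
  have "reduced T U (reduced S T \<rho>) x y
    = (\<Sum>(z,w)\<in>configs (T-U) \<times> configs (S-T). \<rho> (merge U x (merge T z w)) (merge U y (merge T z w)))"
    by (simp add: reduced_def m sum.cartesian_product)
  also have "\<dots> = (\<Sum>z\<in>configs (S-U). \<rho> (merge U x z) (merge U y z))"
    by (rule sum.reindex_bij_witness[where i = "\<lambda>z. (\<lambda>i. i \<in> T \<and> z i, \<lambda>i. i \<notin> T \<and> z i)" and j = "\<lambda>(z,w). merge T z w"])
       ((use assms in \<open>auto simp: configs_def merge_def fun_eq_iff\<close>)[4], auto)
  finally show "reduced T U (reduced S T \<rho>) x y = reduced S U \<rho> x y" by (simp add: reduced_def)
qed

lemma merge_configs: "T \<subseteq> S \<Longrightarrow> x \<in> configs T \<Longrightarrow> z \<in> configs (S - T) \<Longrightarrow> merge T x z \<in> configs S"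
  by (auto simp: configs_def merge_def)

text \<open>The partial trace is linear, so every vector can be reduced separately, with a
  decomposition \<open>us v\<close> adapted to it.\<close>

lemma decomp_reduced:
  assumes "T \<subseteq> S" and d: "decomp S \<rho> vs"
    and us: "\<And>v. v \<in> set vs \<Longrightarrow> decomp T (reduced S T (\<lambda>x y. v x * cnj (v y))) (us v)"
  shows "decomp T (reduced S T \<rho>) (concat (map us vs))"
  unfolding decomp_def
proof (intro ballI)
  fix x y assume xy: "x \<in> configs T" "y \<in> configs T"
  have "reduced S T \<rho> x y = (\<Sum>z\<in>configs (S-T). \<Sum>v\<leftarrow>vs. v (merge T x z) * cnj (v (merge T y z)))"
    unfolding reduced_def
    by (rule sum.cong) (use d xy merge_configs[OF assms(1)] in \<open>auto simp: decomp_def\<close>)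
  also have "\<dots> = (\<Sum>v\<leftarrow>vs. reduced S T (\<lambda>x y. v x * cnj (v y)) x y)"
    unfolding reduced_def by (induction vs) (simp_all add: sum.distrib)
  also have "\<dots> = (\<Sum>v\<leftarrow>vs. \<Sum>u\<leftarrow>us v. u x * cnj (u y))"
    using us xy by (intro arg_cong[of _ _ sum_list] map_cong refl) (simp add: decomp_def)
  also have "\<dots> = (\<Sum>u\<leftarrow>concat (map us vs). u x * cnj (u y))"
    by (induction vs) simp_all
  finally show "reduced S T \<rho> x y = (\<Sum>u\<leftarrow>concat (map us vs). u x * cnj (u y))" .
qed

text \<open>Measuring the traced-out qubits in the computational basis gives one vector per outcome
  \<open>z\<close>.\<close>

lemma decomp_reduced_pure:
  assumes "finite S"
  shows "\<exists>us. decomp T (reduced S T (\<lambda>x y. v x * cnj (v y))) us"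
proof -
  obtain zs where zs: "set zs = configs (S - T)" "distinct zs"
    using finite_distinct_list[of "configs (S - T)"] assms by auto
  have "decomp T (reduced S T (\<lambda>x y. v x * cnj (v y))) (map (\<lambda>z x. v (merge T x z)) zs)"
    unfolding decomp_def reduced_def using zs by (simp add: comp_def sum_list_distinct_conv_sum_set)
  then show ?thesis by blast
qed

lemma decomp_reduced_exists:
  assumes "T \<subseteq> S" "finite S" "decomp S \<rho> vs"
  shows "\<exists>us. decomp T (reduced S T \<rho>) us"
proof -
  obtain us where "\<And>v. decomp T (reduced S T (\<lambda>x y. v x * cnj (v y))) (us v)"
    using decomp_reduced_pure[OF assms(2)] by metis
  then show ?thesis using decomp_reduced[OF assms(1,3)] by blast
qed

lemma is_state_decomp:
  assumes "is_state S \<rho>" "finite S"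
  shows "\<exists>vs. decomp S \<rho> vs"
proof -
  have "\<exists>vs. length vs = card (configs S) \<and>
      (\<forall>x\<in>configs S. \<forall>y\<in>configs S. \<rho> x y = (\<Sum>v\<leftarrow>vs. v x * cnj (v y)))"
    by (rule cholesky[OF finite_configs[OF assms(2)]]) (use assms(1) in \<open>unfold is_state_def, blast+\<close>)
  then show ?thesis unfolding decomp_def by blast
qed

section \<open>Quaternion bases\<close>

text \<open>The element \<open>h4\<close> is determined up to sign by \<open>h2\<close> and \<open>h3\<close>: the traceless part of
  \<open>h2 h3 h4\<close> commutes with both and is therefore a multiple of each of them.\<close>
lemma third_unit:
  assumes tr: "tr2 h2 = 0" "tr2 h3 = 0" "tr2 h4 = 0"
    and d: "det2 h2 = 1" "det2 h3 = 1" "det2 h4 = 1"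
    and o: "polar h2 h3 = 0" "polar h2 h4 = 0" "polar h3 h4 = 0"
  shows "h4 = h2 ** h3 \<or> h4 = msc (-1) (h2 ** h3)"
proof -
  have sq: "h2 ** h2 = msc (-1) (mat 1)" "h3 ** h3 = msc (-1) (mat 1)" "h4 ** h4 = msc (-1) (mat 1)"
    using traceless_sq tr d by fastforce+
  have z: "msc 0 A = 0" for A by (simp add: cmat_simps)
  have ac: "h3 ** h2 = msc (-1) (h2 ** h3)" "h4 ** h2 = msc (-1) (h2 ** h4)" "h4 ** h3 = msc (-1) (h3 ** h4)"
    using traceless_anticomm[OF tr(2,1)] traceless_anticomm[OF tr(3,1)] traceless_anticomm[OF tr(3,2)] o
    by (simp_all add: polar_def z algebra_simps)
  note red = cmat_assoc msc_mult_left msc_mult_right msc_msc square_left[OF sq(1)] square_left[OF sq(2)]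
    square_left[OF sq(3)] anticomm_left[OF ac(1)] anticomm_left[OF ac(2)] anticomm_left[OF ac(3)] sq ac
  define X where "X = h2 ** (h3 ** h4)"
  define t where "t = tr2 X / 2"
  define Y where "Y = X + msc (- t) (mat 1)"
  have trY: "tr2 Y = 0" by (simp add: Y_def t_def tr2_def msc_nth cmat_one_nth)
  have XX: "X ** X = mat 1" by (simp add: X_def red)
  have c2: "Y ** h2 = h2 ** Y" "Y ** h3 = h3 ** Y"
    by (simp_all add: Y_def X_def cmat_add_mult cmat_mult_add red)
  \<comment> \<open>Commuting with \<open>h\<close>, combined with the anticommutation formula,
    makes \<open>Y ** h\<close> scalar; multiplication by \<open>h\<close>, its own inverse up to
    sign, recovers \<open>Y\<close>.\<close>
  have par: "\<exists>a. Y = msc a h" if "tr2 h = 0" "det2 h = 1" "Y ** h = h ** Y" for h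
  proof -
    have "Y ** h = msc (-1) (Y ** h) + msc (- polar Y h) (mat 1)"
      using traceless_anticomm[OF trY that(1)] that(3) by simp
    then have "msc 2 (Y ** h) = msc (- polar Y h) (mat 1)"
      by (simp add: cmat_simps) algebra
    then have "msc 2 (Y ** h) ** h = msc (- polar Y h) (mat 1) ** h" by simp
    moreover have "h ** h = msc (-1) (mat 1)" using traceless_sq[OF that(1)] that(2) by simp
    ultimately have "msc (-2) Y = msc (- polar Y h) h"
      by (simp add: msc_mult_left msc_mult_right cmat_assoc msc_msc)
    then have "Y = msc (polar Y h / 2) h"
      by (simp add: cmat_simps mult.commute[of _ 2])
    then show ?thesis by blast
  qed
  obtain a where a: "Y = msc a h2" using par[OF tr(1) d(1) c2(1)] by blast
  \<comment> \<open>\<open>msc a h2\<close> commutes with \<open>h3\<close> but also anticommutes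
    with it. Cancelling the invertible \<open>h2 ** h3\<close> gives \<open>a = 0\<close>, so
    \<open>X\<close> is a scalar of square one.\<close>
  have "msc a (h2 ** h3) = msc (- a) (h2 ** h3)"
    using c2(2) unfolding a by (simp add: msc_mult_left msc_mult_right ac msc_msc)
  then have "msc a (h2 ** h3) ** adj2 (h2 ** h3) = msc (- a) (h2 ** h3) ** adj2 (h2 ** h3)" by simp
  then have "msc a (mat 1) = msc (-a) (mat 1)" by (simp add: msc_mult_left mult_adj2 det2_mult d)
  then have "a = 0" by (simp add: cmat_simps)
  then have X: "X = msc t (mat 1)" using a by (simp add: Y_def z cmat_simps add_eq_0_iff)
  have "msc (t * t) (mat 1) = mat 1" using XX unfolding X by (simp add: msc_mult_left msc_msc)
  then have "t * t = 1" by (simp add: cmat_simps)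
  then have t: "t = 1 \<or> t = -1" by (metis square_eq_1_iff)
  have "X ** h4 = msc (-1) (h2 ** h3)" by (simp add: X_def red)
  then have "msc t h4 = msc (-1) (h2 ** h3)" unfolding X by (simp add: msc_mult_left)
  then have "msc (t * t) h4 = msc (- t) (h2 ** h3)" by (metis msc_msc mult_minus1_right)
  then show ?thesis using t \<open>t * t = 1\<close> by auto
qed

text \<open>In the Pauli basis such a matrix is a real vector, and \<open>- det2 M\<close> is its
  squared length.\<close>

lemma traceless_hermitian:
  assumes dM: "dag M = M" and trM: "tr2 M = 0"
  shows "M $ True $ True = - M $ False $ False" "M $ True $ False = cnj (M $ False $ True)"
    "Im (M $ False $ False) = 0"
    "det2 M = - of_real ((Re (M $ False $ False))\<^sup>2 + (cmod (M $ False $ True))\<^sup>2)"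
proof -
  have M: "M $ i $ j = cnj (M $ j $ i)" for i j by (metis dM dag_nth)
  show M11: "M $ True $ True = - M $ False $ False" using trM by (simp add: tr2_def add_eq_0_iff)
  show M10: "M $ True $ False = cnj (M $ False $ True)" by (rule M)
  show M00: "Im (M $ False $ False) = 0" using M by (metis Reals_cnj_iff complex_is_Real_iff)
  then have "M $ False $ False = of_real (Re (M $ False $ False))" by (simp add: complex_eq_iff)
  then have "M $ False $ False * M $ False $ False = of_real ((Re (M $ False $ False))\<^sup>2)"
    by (metis of_real_mult power2_eq_square)
  then show "det2 M = - of_real ((Re (M $ False $ False))\<^sup>2 + (cmod (M $ False $ True))\<^sup>2)"
    unfolding det2_def M11 M10(1) of_real_add of_real_minus complex_norm_square by simp
qed

text \<open>\<open>H\<close> sums g g\<dagger> over 1, h2, h3 and h2 h3. Left multiplication by a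
  unit permutes these up to sign, so h H h\<dagger> = H for h = h2, h3, h4. Hence conjugation by
  each unit fixes i h2 H and i h3 H up to sign, and the determinant of the weighted sum splits into
  two squares. Trace zero is one real linear condition on a two-parameter family, so it has a
  nonzero solution.\<close>

lemma quaternion_form:
  assumes tr: "tr2 h2 = 0" "tr2 h3 = 0" "tr2 h4 = 0"
    and d: "det2 h2 = 1" "det2 h3 = 1" "det2 h4 = 1"
    and o: "polar h2 h3 = 0" "polar h2 h4 = 0" "polar h3 h4 = 0"
  obtains N c d where "dag N = N" "tr2 N = 0" "det2 N = -1" "c\<^sup>2 + d\<^sup>2 = (1::real)"
    "\<And>r1 r2 r3 r4 :: real. det2 (msc r1 N + msc r2 (h2 ** N ** dag h2) + msc r3 (h3 ** N ** dag h3)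
        + msc r4 (h4 ** N ** dag h4)) = - complex_of_real ((r1+r2-r3-r4)\<^sup>2 * c\<^sup>2 + (r1-r2+r3-r4)\<^sup>2 * d\<^sup>2)"
proof -
  have sq: "h2 ** h2 = msc (-1) (mat 1)" "h3 ** h3 = msc (-1) (mat 1)"
    using traceless_sq tr d by fastforce+
  have z: "msc 0 A = 0" for A by (simp add: cmat_simps)
  have ac: "h3 ** h2 = msc (-1) (h2 ** h3)"
    using traceless_anticomm[OF tr(2,1)] o by (simp_all add: polar_def z algebra_simps)
  have dsq: "dag h2 ** dag h2 = msc (-1) (mat 1)" "dag h3 ** dag h3 = msc (-1) (mat 1)"
    using arg_cong[OF sq(1), of dag] arg_cong[OF sq(2), of dag]
    by (simp_all add: dag_mult dag_msc)
  have dac: "dag h3 ** dag h2 = msc (-1) (dag h2 ** dag h3)"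
    using arg_cong[OF ac(1), of dag] by (simp add: dag_mult dag_msc msc_msc)
  note red = cmat_assoc msc_mult_left msc_mult_right msc_msc msc_add square_left[OF sq(1)] square_left[OF sq(2)]
    anticomm_left[OF ac(1)] sq ac cmat_add_mult cmat_mult_add
    square_left[OF dsq(1)] square_left[OF dsq(2)] anticomm_left[OF dac(1)] dsq dac dag_mult
  \<comment> \<open>The last summand is \<open>h4 ** dag h4\<close>, because \<open>h4\<close> is
    \<open>h2 ** h3\<close> up to sign.\<close>
  define H where "H = mat 1 + h2 ** dag h2 + h3 ** dag h3 + h2 ** (h3 ** (dag h3 ** dag h2))"
  have H2: "h2 ** (H ** dag h2) = H" and H3: "h3 ** (H ** dag h3) = H"
    by (simp_all add: H_def red add_ac)
  have H4: "h4 ** (H ** dag h4) = H"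
  proof -
    have "h4 ** (H ** dag h4) = h2 ** ((h3 ** (H ** dag h3)) ** dag h2)"
      using third_unit[OF assms] by (auto simp: red dag_msc)
    then show ?thesis by (simp add: H3 H2)
  qed
  have dH: "dag H = H" by (simp add: H_def dag_add dag_mult cmat_assoc)
  \<comment> \<open>Invariance and h^2 = -1 give h H = - H h\<dagger>, so \<open>h ** H\<close> is
    antihermitian and the factor i makes it hermitian.\<close>
  have hermitian: "dag (msc \<i> (h ** H)) = msc \<i> (h ** H)"
    if "h ** h = msc (-1) (mat 1)" "h ** (H ** dag h) = H" for h
  proof -
    have "h ** (h ** (H ** dag h)) = h ** H" using that(2) by simp
    then have "msc (-1) (H ** dag h) = h ** H" by (simp add: square_left[OF that(1)])
    then have "msc \<i> (h ** H) = msc (-\<i>) (H ** dag h)" by (metis msc_msc mult.right_neutral mult_minus_right)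
    then show ?thesis by (simp add: dag_msc dag_mult dH)
  qed
  define N2 where "N2 = msc \<i> (h2 ** H)"
  define N3 where "N3 = msc \<i> (h3 ** H)"
  have dN: "dag N2 = N2" "dag N3 = N3" unfolding N2_def N3_def
    using hermitian[OF sq(1) H2] hermitian[OF sq(2) H3] by auto
  have re: "tr2 X = of_real (Re (tr2 X))" if "dag X = X" for X
    using that by (simp add: cmat_simps tr2_def complex_eq_iff)
  \<comment> \<open>The traces of \<open>N2\<close> and \<open>N3\<close> are real; (c0, d0) is a
    nonzero vector orthogonal to the pair of traces.\<close>
  obtain c0 d0 :: real where cd0: "c0\<^sup>2 + d0\<^sup>2 > 0" "c0 * Re (tr2 N2) + d0 * Re (tr2 N3) = 0"
  proof (cases "Re (tr2 N2) = 0 \<and> Re (tr2 N3) = 0")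
    case True then show ?thesis using that[of 1 0] by simp
  next
    case False then show ?thesis using that[of "Re (tr2 N3)" "- Re (tr2 N2)"]
      by (auto simp: sum_power2_gt_zero_iff)
  qed
  define M where "M = msc c0 N2 + msc d0 N3"
  have Mform: "msc c0 N2 + msc d0 N3 = msc \<i> ((msc c0 h2 + msc d0 h3) ** H)" for c0 d0
    by (simp add: N2_def N3_def red mult.commute)
  have detM: "det2 (msc c0 N2 + msc d0 N3) = - ((c0\<^sup>2 + d0\<^sup>2) * det2 H)" for c0 d0
    unfolding Mform by (simp add: det2_msc det2_mult det2_lincomb d o)
  have dM: "dag M = M" by (simp add: M_def dag_add dag_msc dN)
  have trM: "tr2 M = 0"
  proof -
    have "tr2 M = c0 * tr2 N2 + d0 * tr2 N3" by (simp add: M_def tr2_def msc_nth algebra_simps)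
    also have "\<dots> = of_real (c0 * Re (tr2 N2) + d0 * Re (tr2 N3))"
      using re[OF dN(1)] re[OF dN(2)] by (metis of_real_add of_real_mult)
    finally show ?thesis using cd0 by simp
  qed
  \<comment> \<open>Excludes \<open>H = 0\<close>: its first diagonal entry is one plus squared
    moduli.\<close>
  have H00: "Re (H $ False $ False) \<ge> 1"
  proof -
    have "0 \<le> Re ((X ** dag X) $ False $ False)" for X
      by (simp add: cmat_mult_nth dag_nth)
    from this[of h2] this[of h3] this[of "h2 ** h3"] show ?thesis
      by (simp add: H_def dag_mult cmat_assoc cmat_one_nth)
  qed
  have "M \<noteq> 0"
  proof
    assume "M = 0"
    then have "(msc c0 h2 + msc d0 h3) ** H = 0" unfolding M_def Mform
      by (auto simp: msc_def vec_eq_iff)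
    then have "adj2 (msc c0 h2 + msc d0 h3) ** ((msc c0 h2 + msc d0 h3) ** H) = 0" by (simp add: matrix_matrix_mult_def vec_eq_iff)
    then have "msc (det2 (msc c0 h2 + msc d0 h3)) H = 0"
      using mult_adj2[of "adj2 (msc c0 h2 + msc d0 h3)"]
      by (simp add: cmat_assoc[symmetric] det2_adj2 msc_mult_left)
    moreover have "det2 (msc c0 h2 + msc d0 h3) = of_real (c0\<^sup>2 + d0\<^sup>2)" by (simp add: det2_lincomb d o)
    ultimately have "msc (of_real (c0\<^sup>2 + d0\<^sup>2)) H = 0" by (simp only:)
    moreover have "complex_of_real (c0\<^sup>2 + d0\<^sup>2) \<noteq> 0" using cd0(1) by (simp only: of_real_eq_0_iff)
    ultimately have "H = 0" unfolding msc_def vec_eq_iff by (simp only: vec_lambda_beta mult_eq_0_iff zero_index) blast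
    then show False using H00 by simp
  qed
  define e where "e = - Re (det2 M)"
  note M = traceless_hermitian[OF dM trM]
  from M(4)
  have det_e: "det2 M = - of_real e" and e: "e = (Re (M $ False $ False))\<^sup>2 + (cmod (M $ False $ True))\<^sup>2"
     by (simp_all add: e_def)
  have epos: "e > 0"
  proof (rule ccontr)
    assume "\<not> e > 0"
    then have "(Re (M $ False $ False))\<^sup>2 + (cmod (M $ False $ True))\<^sup>2 \<le> 0" using e by simp
    then have "Re (M $ False $ False) = 0" "M $ False $ True = 0"
      by (simp_all add: sum_power2_le_zero_iff)
    then show False using \<open>M \<noteq> 0\<close> M by (simp add: cmat_simps complex_eq_iff)
  qed
  define q where "q = sqrt (c0\<^sup>2 + d0\<^sup>2)"
  define \<epsilon> where "\<epsilon> = 1 / sqrt e"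
  define N where "N = msc \<epsilon> M"
  have q: "q > 0" "q\<^sup>2 = c0\<^sup>2 + d0\<^sup>2" using cd0(1) by (simp_all add: q_def)
  have ee: "\<epsilon>\<^sup>2 * e = 1" using epos by (simp add: \<epsilon>_def power_divide)
  \<comment> \<open>Comparing the two expressions for \<open>det2 M\<close> shows that
    \<open>det2 H\<close> is the positive real e/q^2, which the scaling by \<open>\<epsilon>\<close>
    then cancels.\<close>
  have eH: "of_real (q\<^sup>2) * det2 H = of_real e"
    using det_e detM[of c0 d0] unfolding M_def[symmetric] q by simp
  show ?thesis
  proof (rule that[of N "c0 / q" "d0 / q"])
    show "dag N = N" by (simp add: N_def dag_msc dM)
    show "tr2 N = 0" using trM by (simp add: N_def tr2_def msc_nth flip: distrib_left)
    show "det2 N = -1" using ee by (simp add: N_def det2_msc det_e flip: of_real_power of_real_mult)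
    show "(c0 / q)\<^sup>2 + (d0 / q)\<^sup>2 = 1" using q(1) by (simp add: power_divide q(2)[symmetric] flip: add_divide_distrib)
    fix r1 r2 r3 r4 :: real
    \<comment> \<open>\<open>h\<close> moves past \<open>k\<close> at the price of the scalar and is
      then absorbed by the invariance of \<open>H\<close>.\<close>
    have conj: "h ** msc \<i> (k ** H) ** dag h = msc e (msc \<i> (k ** H))"
      if "h ** k = msc e (k ** h)" "h ** (H ** dag h) = H" for h k e
    proof -
      have "h ** (k ** (H ** dag h)) = msc e (k ** (h ** (H ** dag h)))"
        by (metis that(1) cmat_assoc msc_mult_left)
      then show ?thesis by (simp add: msc_mult_left msc_mult_right cmat_assoc that(2) msc_msc mult.commute)
    qed
    have ca: "h2 ** h3 = msc (-1) (h3 ** h2)" by (simp add: ac msc_msc)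
    have h2: "h2 ** N2 ** dag h2 = N2" "h2 ** N3 ** dag h2 = msc (-1) N3"
      unfolding N2_def N3_def using conj[of h2 h2 1] conj[OF ca] H2 by simp_all
    have h3: "h3 ** N2 ** dag h3 = msc (-1) N2" "h3 ** N3 ** dag h3 = N3"
      unfolding N2_def N3_def using conj[of h3 h3 1] conj[OF ac] H3 by simp_all
    have h4: "h4 ** N2 ** dag h4 = msc (-1) N2" "h4 ** N3 ** dag h4 = msc (-1) N3"
    proof -
      have "h4 ** X ** dag h4 = h2 ** (h3 ** X ** dag h3) ** dag h2" for X
        using third_unit[OF assms] by (auto simp: red dag_msc)
      then show "h4 ** N2 ** dag h4 = msc (-1) N2" "h4 ** N3 ** dag h4 = msc (-1) N3"
        using h2 h3 by (simp_all add: msc_mult_left msc_mult_right)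
    qed
    have "msc r1 N + msc r2 (h2 ** N ** dag h2) + msc r3 (h3 ** N ** dag h3) + msc r4 (h4 ** N ** dag h4)
      = msc (of_real (\<epsilon> * c0 * (r1+r2-r3-r4))) N2 + msc (of_real (\<epsilon> * d0 * (r1-r2+r3-r4))) N3"
      unfolding N_def M_def
      by (simp add: cmat_mult_add cmat_add_mult msc_mult_left msc_mult_right h2 h3 h4)
         (simp add: cmat_simps algebra_simps)
    then have "det2 (msc r1 N + msc r2 (h2 ** N ** dag h2) + msc r3 (h3 ** N ** dag h3) + msc r4 (h4 ** N ** dag h4))
      = - (of_real ((\<epsilon> * c0 * (r1+r2-r3-r4))\<^sup>2 + (\<epsilon> * d0 * (r1-r2+r3-r4))\<^sup>2) * det2 H)"
      by (simp only: detM) simp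
    also have "(\<epsilon> * c0 * (r1+r2-r3-r4))\<^sup>2 + (\<epsilon> * d0 * (r1-r2+r3-r4))\<^sup>2
        = \<epsilon>\<^sup>2 * ((r1+r2-r3-r4)\<^sup>2 * (c0/q)\<^sup>2 + (r1-r2+r3-r4)\<^sup>2 * (d0/q)\<^sup>2) * q\<^sup>2"
      using q(1) by (simp add: power_mult_distrib power_divide distrib_left distrib_right)
    also have "of_real (\<epsilon>\<^sup>2 * ((r1+r2-r3-r4)\<^sup>2 * (c0/q)\<^sup>2 + (r1-r2+r3-r4)\<^sup>2 * (d0/q)\<^sup>2) * q\<^sup>2) * det2 H
        = of_real (\<epsilon>\<^sup>2 * ((r1+r2-r3-r4)\<^sup>2 * (c0/q)\<^sup>2 + (r1-r2+r3-r4)\<^sup>2 * (d0/q)\<^sup>2)) * (of_real (q\<^sup>2) * det2 H)"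
      by (simp only: of_real_mult mult.assoc)
    also have "- \<dots> = - of_real (((r1+r2-r3-r4)\<^sup>2 * (c0/q)\<^sup>2 + (r1-r2+r3-r4)\<^sup>2 * (d0/q)\<^sup>2) * (\<epsilon>\<^sup>2 * e))"
      unfolding eH of_real_mult by (simp only: mult_ac)
    finally show "det2 (msc r1 N + msc r2 (h2 ** N ** dag h2) + msc r3 (h3 ** N ** dag h3) + msc r4 (h4 ** N ** dag h4))
      = - complex_of_real ((r1+r2-r3-r4)\<^sup>2 * (c0/q)\<^sup>2 + (r1-r2+r3-r4)\<^sup>2 * (d0/q)\<^sup>2)"
      using ee by simp
  qed
qed

text \<open>Such an \<open>N\<close> has eigenvalues 1 and -1, so N = 2 |b><b| - 1 with the unit
  eigenvector b = (\<beta>, \<gamma>); the entries spell this out.\<close>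

lemma spinor:
  assumes N: "dag N = N" "tr2 N = 0" "det2 N = -1"
  obtains \<beta> \<gamma> where "(cmod \<beta>)\<^sup>2 + (cmod \<gamma>)\<^sup>2 = 1" "N $ False $ False = \<beta> * cnj \<beta> - \<gamma> * cnj \<gamma>"
    "N $ False $ True = 2 * \<beta> * cnj \<gamma>" "N $ True $ False = 2 * cnj \<beta> * \<gamma>" "N $ True $ True = \<gamma> * cnj \<gamma> - \<beta> * cnj \<beta>"
proof -
  note h = traceless_hermitian[OF N(1,2)]
  define z where "z = Re (N $ False $ False)"
  define w where "w = N $ False $ True"
  have N00: "N $ False $ False = of_real z" using h(3) by (simp add: z_def complex_eq_iff)
  have "complex_of_real (z\<^sup>2 + (cmod w)\<^sup>2) = 1"
    using h(4) N(3) unfolding z_def w_def by (metis neg_equal_iff_equal)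
  then have zw: "z\<^sup>2 + (cmod w)\<^sup>2 = 1" by (simp only: of_real_eq_1_iff)
  have "z\<^sup>2 \<le> 1" using zw zero_le_power2[of "cmod w"] by linarith
  then have z1: "-1 \<le> z" by (simp add: abs_square_le_1)
  have "\<exists>\<beta> \<gamma>. (cmod \<beta>)\<^sup>2 = (1 + z) / 2 \<and> (cmod \<gamma>)\<^sup>2 = (1 - z) / 2 \<and> 2 * \<beta> * cnj \<gamma> = w"
  \<comment> \<open>At this pole \<beta> is 0 and cannot be divided by. Elsewhere \<beta> is chosen
    real and positive, which determines \<gamma>.\<close>
  proof (cases "z = -1")
    case True
    then have "w = 0" using zw by simp
    then show ?thesis using True by (intro exI[of _ 0] exI[of _ 1]) simp
  next
    case False
    define b where "b = sqrt ((1 + z) / 2)"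
    have b: "b > 0" "b\<^sup>2 = (1 + z) / 2" using z1 False by (simp_all add: b_def)
    have "(cmod (cnj w / (2 * b)))\<^sup>2 = (cmod w)\<^sup>2 / (4 * b\<^sup>2)"
      using b by (simp add: norm_divide norm_mult power_divide power_mult_distrib)
    also have "(cmod w)\<^sup>2 = (1 - z) * (1 + z)" using zw by (simp add: algebra_simps power2_eq_square)
    also have "\<dots> / (4 * b\<^sup>2) = (1 - z) / 2"
    proof -
      have "1 + z \<noteq> 0" using False by linarith
      then show ?thesis unfolding b(2) by (simp add: divide_simps)
    qed
    finally have "(cmod (cnj w / (2 * b)))\<^sup>2 = (1 - z) / 2" .
    then show ?thesis using b by (intro exI[of _ "of_real b"] exI[of _ "cnj w / (2 * b)"]) simp
  qed
  then obtain \<beta> \<gamma> where \<beta>: "(cmod \<beta>)\<^sup>2 = (1 + z) / 2" and \<gamma>: "(cmod \<gamma>)\<^sup>2 = (1 - z) / 2" and w: "2 * \<beta> * cnj \<gamma> = w"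
    by blast
  have "\<beta> * cnj \<beta> - \<gamma> * cnj \<gamma> = of_real ((cmod \<beta>)\<^sup>2 - (cmod \<gamma>)\<^sup>2)"
    by (simp only: of_real_diff complex_norm_square)
  also have "(cmod \<beta>)\<^sup>2 - (cmod \<gamma>)\<^sup>2 = z" unfolding \<beta> \<gamma> by (simp add: field_simps)
  finally have zz: "N $ False $ False = \<beta> * cnj \<beta> - \<gamma> * cnj \<gamma>" using N00 by simp
  show ?thesis
  proof (rule that[of \<beta> \<gamma>])
    show "(cmod \<beta>)\<^sup>2 + (cmod \<gamma>)\<^sup>2 = 1" unfolding \<beta> \<gamma> by (simp add: field_simps)
    show "N $ False $ True = 2 * \<beta> * cnj \<gamma>" using w by (simp add: w_def)
    show "N $ True $ False = 2 * cnj \<beta> * \<gamma>" unfolding h(2) w_def[symmetric] w[symmetric] by simp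
    show "N $ True $ True = \<gamma> * cnj \<gamma> - \<beta> * cnj \<beta>" unfolding h(1) zz by simp
  qed (rule zz)
qed

section \<open>Decompositions of a two-qubit operator into four vectors\<close>

text \<open>Length four, the dimension of the space, always suffices for a positive semidefinite
  operator. Fixing it makes the decompositions a compact subset of a Euclidean space.\<close>

definition dec4 :: "(bool \<times> bool \<Rightarrow> bool \<times> bool \<Rightarrow> complex) \<Rightarrow> (cmat^4) set" where
  "dec4 \<rho> = {W. \<forall>a b c d. (\<Sum>s\<in>UNIV. W $ s $ a $ b * cnj (W $ s $ c $ d)) = \<rho> (a,b) (c,d)}"

text \<open>The partial trace over \<open>B\<close> of \<open>\<rho> (1 \<otimes> N\<^sup>T)\<close>, for \<open>\<rho>\<close> indexed by pairs of basis states of \<open>A\<close> and \<open>B\<close>.\<close>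
definition cond_op :: "(bool \<times> bool \<Rightarrow> bool \<times> bool \<Rightarrow> complex) \<Rightarrow> cmat \<Rightarrow> cmat" where
  "cond_op \<rho> N = (\<chi> a c. \<Sum>b\<in>UNIV. \<Sum>d\<in>UNIV. N $ b $ d * \<rho> (a,b) (c,d))"

lemma cond_op_dec4:
  assumes "W \<in> dec4 \<rho>"
  shows "cond_op \<rho> N = (\<Sum>s\<in>UNIV. W $ s ** N ** dag (W $ s))"
proof -
  have \<rho>: "\<rho> (a,b) (c,d) = (\<Sum>s\<in>UNIV. W $ s $ a $ b * cnj (W $ s $ c $ d))" for a b c d
    using assms by (simp add: dec4_def)
  show ?thesis
    by (simp add: cond_op_def \<rho> cmat_simps UNIV_bool sum.distrib sum_distrib_left algebra_simps)
qed

text \<open>A diagonal entry of \<rho> is the sum of the squared moduli of the entries of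
  \<open>W\<close> at that position, which bounds all decompositions uniformly.\<close>

lemma norm_dec4_le:
  assumes "W \<in> dec4 \<rho>"
  shows "norm W \<le> (\<Sum>s\<in>(UNIV::4 set). \<Sum>a\<in>UNIV. \<Sum>b\<in>UNIV. sqrt (cmod (\<rho> (a,b) (a,b))))"
proof -
  have "cmod (W $ s $ a $ b) \<le> sqrt (cmod (\<rho> (a,b) (a,b)))" for s a b
  proof -
    have "\<rho> (a,b) (a,b) = (\<Sum>s\<in>UNIV. W $ s $ a $ b * cnj (W $ s $ a $ b))"
      using assms by (simp add: dec4_def)
    also have "\<dots> = of_real (\<Sum>s\<in>UNIV. (cmod (W $ s $ a $ b))\<^sup>2)"
      by (simp add: complex_norm_square[symmetric])
    finally have "cmod (\<rho> (a,b) (a,b)) = (\<Sum>s\<in>UNIV. (cmod (W $ s $ a $ b))\<^sup>2)"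
      by (simp only: norm_of_real) (simp add: sum_nonneg)
    moreover have "(cmod (W $ s $ a $ b))\<^sup>2 \<le> (\<Sum>s\<in>UNIV. (cmod (W $ s $ a $ b))\<^sup>2)"
      by (rule member_le_sum) auto
    ultimately show ?thesis by (simp add: real_le_rsqrt)
  qed
  then have "norm (W $ s $ a) \<le> (\<Sum>b\<in>UNIV. sqrt (cmod (\<rho> (a,b) (a,b))))" for s a
    unfolding norm_vec_def by (intro order.trans[OF L2_set_le_sum] sum_mono) auto
  then have "norm (W $ s) \<le> (\<Sum>a\<in>UNIV. \<Sum>b\<in>UNIV. sqrt (cmod (\<rho> (a,b) (a,b))))" for s
    unfolding norm_vec_def[of "W $ s"] by (intro order.trans[OF L2_set_le_sum] sum_mono) auto
  then show ?thesis
    unfolding norm_vec_def[of W] by (intro order.trans[OF L2_set_le_sum] sum_mono) auto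
qed

lemma compact_dec4: "compact (dec4 \<rho>)"
proof -
  have "closed (dec4 \<rho>)" unfolding dec4_def
    by (intro closed_Collect_all closed_Collect_eq continuous_intros)
  moreover have "bounded (dec4 \<rho>)" unfolding bounded_iff using norm_dec4_le by blast
  ultimately show ?thesis by (simp add: compact_eq_bounded_closed)
qed

lemma sum_UNIV_two:
  fixes g :: "'n::finite \<Rightarrow> 'a::comm_monoid_add"
  assumes "s \<noteq> t"
  shows "sum g UNIV = g s + g t + sum g (UNIV - {s,t})"
proof -
  have "sum g UNIV = g s + sum g (UNIV - {s})" by (rule sum.remove) auto
  also have "sum g (UNIV - {s}) = g t + sum g (UNIV - {s} - {t})" using assms by (intro sum.remove) auto
  finally show ?thesis by (simp add: Diff_insert[symmetric] insert_commute add.assoc)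
qed

text \<open>Mixes the vectors \<open>s\<close> and \<open>t\<close> by the matrix with rows (x, y)
  and (- cnj y, cnj x), unitary when x and y are normalised.\<close>

definition rotate2 :: "4 \<Rightarrow> 4 \<Rightarrow> complex \<Rightarrow> complex \<Rightarrow> cmat^4 \<Rightarrow> cmat^4" where
  "rotate2 s t x y W = (\<chi> r. if r = s then msc x (W $ s) + msc y (W $ t)
     else if r = t then msc (- cnj y) (W $ s) + msc (cnj x) (W $ t) else W $ r)"

lemma rotate2_nth:
  "s \<noteq> t \<Longrightarrow> rotate2 s t x y W $ s = msc x (W $ s) + msc y (W $ t)"
  "s \<noteq> t \<Longrightarrow> rotate2 s t x y W $ t = msc (- cnj y) (W $ s) + msc (cnj x) (W $ t)"
  "r \<noteq> s \<Longrightarrow> r \<noteq> t \<Longrightarrow> rotate2 s t x y W $ r = W $ r"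
  by (auto simp: rotate2_def)

lemma rotate2_dec4:
  assumes W: "W \<in> dec4 \<rho>" and "s \<noteq> t" and xy: "x * cnj x + y * cnj y = 1"
  shows "rotate2 s t x y W \<in> dec4 \<rho>"
  unfolding dec4_def
proof (intro CollectI allI)
  fix a b c d
  let ?V = "rotate2 s t x y W"
  have "(\<Sum>r\<in>UNIV. ?V $ r $ a $ b * cnj (?V $ r $ c $ d))
    = (x * cnj x + y * cnj y) * (W $ s $ a $ b * cnj (W $ s $ c $ d) + W $ t $ a $ b * cnj (W $ t $ c $ d))
      + (\<Sum>r\<in>UNIV-{s,t}. ?V $ r $ a $ b * cnj (?V $ r $ c $ d))"
    unfolding sum_UNIV_two[OF \<open>s \<noteq> t\<close>]
    by (simp add: rotate2_nth \<open>s \<noteq> t\<close> msc_nth algebra_simps)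
  also have "(\<Sum>r\<in>UNIV-{s,t}. ?V $ r $ a $ b * cnj (?V $ r $ c $ d))
      = (\<Sum>r\<in>UNIV-{s,t}. W $ r $ a $ b * cnj (W $ r $ c $ d))"
    by (rule sum.cong) (auto simp: rotate2_nth)
  finally have "(\<Sum>r\<in>UNIV. ?V $ r $ a $ b * cnj (?V $ r $ c $ d))
      = (\<Sum>r\<in>UNIV. W $ r $ a $ b * cnj (W $ r $ c $ d))"
    unfolding xy sum_UNIV_two[OF \<open>s \<noteq> t\<close>, of "\<lambda>r. W $ r $ a $ b * cnj (W $ r $ c $ d)"] by simp
  then show "(\<Sum>r\<in>UNIV. ?V $ r $ a $ b * cnj (?V $ r $ c $ d)) = \<rho> (a,b) (c,d)"
    using W by (simp add: dec4_def)
qed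

text \<open>Takagi factorisation of the symmetric matrix of polarised determinants, obtained in one stroke:
  distinct weights make every maximiser of the weighted sum of determinants diagonal and sorted.\<close>
lemma takagi_dec4:
  assumes ne: "dec4 \<rho> \<noteq> {}"
  obtains W and D :: "4 \<Rightarrow> real" where "W \<in> dec4 \<rho>" "\<And>s. det2 (W $ s) = D s" "\<And>s. D s \<ge> 0"
    "D 1 \<ge> D 2" "D 2 \<ge> D 3" "D 3 \<ge> D 4" "\<And>s t. s \<noteq> t \<Longrightarrow> polar (W $ s) (W $ t) = 0"
proof -
  \<comment> \<open>Positivity makes the maximal determinants real and nonnegative, the decreasing
    order sorts them, and distinctness removes the real parts of the polarised ones.\<close>
  define c :: "4 \<Rightarrow> real" where "c s = (if s = 1 then 4 else if s = 2 then 3 else if s = 3 then 2 else 1)" for s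
  have cpos: "c s > 0" for s by (simp add: c_def)
  have cinj: "c s \<noteq> c t" if "s \<noteq> t" for s t
    using that exhaust_4[of s] exhaust_4[of t] by (auto simp: c_def)
  define f where "f W = (\<Sum>s\<in>UNIV. c s * Re (det2 (W $ s)))" for W :: "cmat^4"
  have "continuous_on (dec4 \<rho>) f" unfolding f_def det2_def by (intro continuous_intros)
  then obtain W where W: "W \<in> dec4 \<rho>" and max: "\<And>V. V \<in> dec4 \<rho> \<Longrightarrow> f V \<le> f W"
    using continuous_attains_sup[OF compact_dec4 ne] by blast
  \<comment> \<open>Maximality tested against a rotation of \<open>s\<close> and \<open>t\<close>;
    all other summands cancel.\<close>
  have rot: "c s * Re (x\<^sup>2 * det2 (W $ s) + y\<^sup>2 * det2 (W $ t) + x * y * polar (W $ s) (W $ t))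
     + c t * Re ((cnj y)\<^sup>2 * det2 (W $ s) + (cnj x)\<^sup>2 * det2 (W $ t) - cnj y * cnj x * polar (W $ s) (W $ t))
     \<le> c s * Re (det2 (W $ s)) + c t * Re (det2 (W $ t))"
    if "s \<noteq> t" "x * cnj x + y * cnj y = 1" for s t x y
  proof -
    let ?V = "rotate2 s t x y W"
    have "(\<Sum>r\<in>UNIV-{s,t}. c r * Re (det2 (?V $ r))) = (\<Sum>r\<in>UNIV-{s,t}. c r * Re (det2 (W $ r)))"
      by (rule sum.cong) (auto simp: rotate2_nth)
    moreover have "f ?V \<le> f W" using max rotate2_dec4[OF W that] by blast
    ultimately have "c s * Re (det2 (?V $ s)) + c t * Re (det2 (?V $ t)) \<le> c s * Re (det2 (W $ s)) + c t * Re (det2 (W $ t))"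
      unfolding f_def sum_UNIV_two[OF that(1)] by linarith
    then show ?thesis by (simp only: rotate2_nth that(1) det2_lincomb not_False_eq_True) simp
  qed
  have real: "det2 (W $ s) = of_real (cmod (det2 (W $ s)))" for s
  proof (cases "det2 (W $ s) = 0")
    case False
    \<comment> \<open>A phase whose square turns the determinant into its modulus.\<close>
    define e where "e = csqrt (cnj (det2 (W $ s)) / cmod (det2 (W $ s)))"
    have "(cmod e)\<^sup>2 = 1"
      using False by (simp add: e_def norm_divide flip: norm_power)
    then have e1: "e * cnj e = 1" by (simp flip: complex_norm_square)
    have e2: "e\<^sup>2 * det2 (W $ s) = of_real (cmod (det2 (W $ s)))"
    proof -
      have "e\<^sup>2 * det2 (W $ s) = det2 (W $ s) * cnj (det2 (W $ s)) / cmod (det2 (W $ s))"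
        by (simp add: e_def)
      also have "\<dots> = of_real (cmod (det2 (W $ s)))"
        by (simp add: complex_norm_square[symmetric] power2_eq_square)
      finally show ?thesis .
    qed
    obtain t where "s \<noteq> t"
    proof (cases "s = 1")
      case True
      then show ?thesis by (intro that[of 2]) simp
    qed auto
    define V where "V = (\<chi> r. if r = s then msc e (W $ s) else W $ r)"
    have "V \<in> dec4 \<rho>" unfolding dec4_def
    proof (intro CollectI allI)
      fix a b c d
      have "V $ r $ a $ b * cnj (V $ r $ c $ d) = W $ r $ a $ b * cnj (W $ r $ c $ d)" for r
        using e1 by (simp add: V_def msc_nth)
      then show "(\<Sum>r\<in>UNIV. V $ r $ a $ b * cnj (V $ r $ c $ d)) = \<rho> (a,b) (c,d)"
        using W by (simp add: dec4_def)
    qed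
    then have "f V \<le> f W" by (rule max)
    moreover have "(\<Sum>r\<in>UNIV-{s,t}. c r * Re (det2 (V $ r))) = (\<Sum>r\<in>UNIV-{s,t}. c r * Re (det2 (W $ r)))"
      by (rule sum.cong) (auto simp: V_def)
    ultimately have "c s * Re (det2 (V $ s)) \<le> c s * Re (det2 (W $ s))"
      unfolding f_def sum_UNIV_two[OF \<open>s \<noteq> t\<close>] using \<open>s \<noteq> t\<close> by (simp add: V_def)
    then have "cmod (det2 (W $ s)) \<le> Re (det2 (W $ s))"
      using cpos[of s] by (simp add: V_def det2_msc e2)
    then have "Re (det2 (W $ s)) = cmod (det2 (W $ s))" by (simp add: antisym complex_Re_le_cmod)
    moreover from this have "Im (det2 (W $ s)) = 0"
      using cmod_power2[of "det2 (W $ s)"] by simp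
    ultimately show ?thesis by (simp add: complex_eq_iff)
  qed simp
  define D where "D s = cmod (det2 (W $ s))" for s
  have D: "det2 (W $ s) = D s" for s using real by (simp add: D_def)
  have "D s \<ge> D t" if "c s > c t" for s t
  proof -
    have "s \<noteq> t" using that by auto
    \<comment> \<open>The rotation with x = 0 and y = 1 swaps the two vectors up to sign.\<close>
    then have "c s * D t + c t * D s \<le> c s * D s + c t * D t"
      using rot[of s t 0 1] by (simp add: D)
    then have "0 \<le> (c s - c t) * (D s - D t)" by (simp add: algebra_simps)
    then show ?thesis using that by (simp add: zero_le_mult_iff)
  qed
  then have "D 1 \<ge> D 2" "D 2 \<ge> D 3" "D 3 \<ge> D 4" by (simp_all add: c_def)
  moreover have "polar (W $ s) (W $ t) = 0" if "s \<noteq> t" for s t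
  proof -
    define p where "p = polar (W $ s) (W $ t)"
    have norm1: "of_real (x / sqrt (x\<^sup>2+1)) * cnj (of_real (x / sqrt (x\<^sup>2+1))) + z / sqrt (x\<^sup>2+1) * cnj (z / sqrt (x\<^sup>2+1)) = 1"
      if "z * cnj z = 1" for x and z :: complex
    proof -
      have "sqrt (x\<^sup>2+1) * sqrt (x\<^sup>2+1) = x\<^sup>2 + 1" by simp
      then have q: "complex_of_real (sqrt (x\<^sup>2+1)) * complex_of_real (sqrt (x\<^sup>2+1)) = of_real (x\<^sup>2 + 1)"
        by (metis of_real_mult)
      have nz: "complex_of_real (x\<^sup>2 + 1) \<noteq> 0" by (metis add_nonneg_pos of_real_eq_0_iff less_irrefl zero_le_power2 zero_less_one)
      have "of_real (x / sqrt (x\<^sup>2+1)) * cnj (of_real (x / sqrt (x\<^sup>2+1))) + z / sqrt (x\<^sup>2+1) * cnj (z / sqrt (x\<^sup>2+1))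
        = (of_real (x * x) + z * cnj z) / (complex_of_real (sqrt (x\<^sup>2+1)) * complex_of_real (sqrt (x\<^sup>2+1)))"
        by (simp add: add_divide_distrib)
      also have "\<dots> = 1" unfolding q that using nz by (simp add: power2_eq_square)
      finally show ?thesis .
    qed
    \<comment> \<open>Rotation by (x, 1)/sqrt(x^2+1), multiplied through by x^2+1. The quadratic
      terms cancel, leaving an affine function of \<open>x\<close> whose slope contains
      \<open>Re p\<close>.\<close>
    have A: "(c s * D t + c t * D s - c s * D s - c t * D t) + (c s - c t) * Re p * x \<le> 0" for x
    proof -
      define q where "q = sqrt (x\<^sup>2+1)"
      have q: "q > 0" "q\<^sup>2 = x\<^sup>2 + 1" by (simp_all add: q_def add_nonneg_pos)
      have "c s * ((x/q)\<^sup>2 * D s + (1/q)\<^sup>2 * D t + (x/q) * (1/q) * Re p)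
        + c t * ((1/q)\<^sup>2 * D s + (x/q)\<^sup>2 * D t - (1/q) * (x/q) * Re p) \<le> c s * D s + c t * D t"
        using rot[OF that norm1[of 1 x]] unfolding q_def[symmetric] D p_def[symmetric]
        by (simp add: power_divide flip: of_real_power of_real_mult)
      then have "(c s * ((x/q)\<^sup>2 * D s + (1/q)\<^sup>2 * D t + (x/q) * (1/q) * Re p)
        + c t * ((1/q)\<^sup>2 * D s + (x/q)\<^sup>2 * D t - (1/q) * (x/q) * Re p)) * q\<^sup>2 \<le> (c s * D s + c t * D t) * q\<^sup>2"
        using q by (intro mult_right_mono) auto
      moreover have "(c s * ((x/q)\<^sup>2 * D s + (1/q)\<^sup>2 * D t + (x/q) * (1/q) * Re p)
        + c t * ((1/q)\<^sup>2 * D s + (x/q)\<^sup>2 * D t - (1/q) * (x/q) * Re p)) * q\<^sup>2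
        = c s * (x\<^sup>2 * D s + D t + x * Re p) + c t * (D s + x\<^sup>2 * D t - x * Re p)"
        using q(1) by (simp add: field_simps power2_eq_square)
      ultimately show ?thesis unfolding q(2) by (simp add: algebra_simps)
    qed
    \<comment> \<open>The entry i in place of 1 exposes \<open>Im p\<close>; the weights now add, so
      their positivity suffices.\<close>
    have B: "(- c s * D t - c t * D s - c s * D s - c t * D t) + - ((c s + c t) * Im p) * x \<le> 0" for x
    proof -
      define q where "q = sqrt (x\<^sup>2+1)"
      have q: "q > 0" "q\<^sup>2 = x\<^sup>2 + 1" by (simp_all add: q_def add_nonneg_pos)
      have "c s * ((x/q)\<^sup>2 * D s - (1/q)\<^sup>2 * D t - (x/q) * (1/q) * Im p)
        + c t * (- (1/q)\<^sup>2 * D s + (x/q)\<^sup>2 * D t - (1/q) * (x/q) * Im p) \<le> c s * D s + c t * D t"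
        using rot[OF that norm1[of \<i> x]] unfolding q_def[symmetric] D p_def[symmetric]
        by (simp add: power_divide flip: of_real_power of_real_mult)
      then have "(c s * ((x/q)\<^sup>2 * D s - (1/q)\<^sup>2 * D t - (x/q) * (1/q) * Im p)
        + c t * (- (1/q)\<^sup>2 * D s + (x/q)\<^sup>2 * D t - (1/q) * (x/q) * Im p)) * q\<^sup>2 \<le> (c s * D s + c t * D t) * q\<^sup>2"
        using q by (intro mult_right_mono) auto
      moreover have "(c s * ((x/q)\<^sup>2 * D s - (1/q)\<^sup>2 * D t - (x/q) * (1/q) * Im p)
        + c t * (- (1/q)\<^sup>2 * D s + (x/q)\<^sup>2 * D t - (1/q) * (x/q) * Im p)) * q\<^sup>2
        = c s * (x\<^sup>2 * D s - D t - x * Im p) + c t * (- D s + x\<^sup>2 * D t - x * Im p)"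
        using q(1) by (simp add: field_simps power2_eq_square)
      ultimately show ?thesis unfolding q(2) by (simp add: algebra_simps)
    qed
    have "(c s - c t) * Re p = 0" by (rule linear_bounded_above_zero[OF A])
    moreover have "- ((c s + c t) * Im p) = 0" by (rule linear_bounded_above_zero[OF B])
    ultimately have "Re p = 0" "Im p = 0" using cinj[OF that] cpos[of s] cpos[of t] by auto
    then show ?thesis by (simp add: p_def complex_eq_iff)
  qed
  ultimately show ?thesis using that[OF W D] by (simp add: D_def)
qed

section \<open>Two-qubit operators: the definite case and the limit\<close>

lemma sum_bool_prod:
  "(\<Sum>p\<in>(UNIV :: (bool \<times> bool) set). g p) = g (False,False) + g (False,True) + g (True,False) + (g (True,True) :: 'a::comm_monoid_add)"
proof -
  have "(\<Sum>p\<in>(UNIV :: (bool \<times> bool) set). g p) = (\<Sum>a\<in>UNIV. \<Sum>b\<in>UNIV. g (a,b))"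
    by (simp add: sum.cartesian_product)
  then show ?thesis by (simp add: UNIV_bool add_ac)
qed

definition qform :: "('i::finite \<Rightarrow> 'i \<Rightarrow> complex) \<Rightarrow> ('i \<Rightarrow> complex) \<Rightarrow> complex" where
  "qform \<rho> v = (\<Sum>x\<in>UNIV. \<Sum>y\<in>UNIV. cnj (v x) * \<rho> x y * v y)"

lemma qform_dec4:
  assumes "W \<in> dec4 \<rho>"
  shows "qform \<rho> v = (\<Sum>s\<in>UNIV. (\<Sum>(a,b)\<in>UNIV. cnj (v (a,b)) * W $ s $ a $ b) * cnj (\<Sum>(a,b)\<in>UNIV. cnj (v (a,b)) * W $ s $ a $ b))"
proof -
  have \<rho>: "\<rho> (a,b) (c,d) = (\<Sum>s\<in>UNIV. W $ s $ a $ b * cnj (W $ s $ c $ d))" for a b c d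
    using assms by (simp add: dec4_def)
  show ?thesis
    by (simp add: qform_def sum_bool_prod \<rho> sum_4 algebra_simps)
qed

lemma dec4_nonempty:
  assumes herm: "\<And>x y. \<rho> x y = cnj (\<rho> y x)" and psd: "\<And>v. 0 \<le> Re (qform \<rho> v)"
  shows "dec4 \<rho> \<noteq> {}"
proof -
  have "\<exists>vs. length vs = card (UNIV :: (bool \<times> bool) set) \<and>
      (\<forall>x\<in>UNIV. \<forall>y\<in>UNIV. \<rho> x y = (\<Sum>v\<leftarrow>vs. v x * cnj (v y)))"
    by (rule cholesky[OF finite herm psd[unfolded qform_def]])
  then obtain vs where len: "length vs = 4" and vs: "\<And>x y. \<rho> x y = (\<Sum>v\<leftarrow>vs. v x * cnj (v y))"
    by auto
  then obtain v1 v2 v3 v4 where v: "vs = [v1,v2,v3,v4]"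
    by (auto simp: numeral_eq_Suc length_Suc_conv)
  define W :: "cmat^4" where
    "W = (\<chi> s a b. (if s = 1 then v1 else if s = 2 then v2 else if s = 3 then v3 else v4) (a,b))"
  have "W \<in> dec4 \<rho>" by (simp add: dec4_def W_def sum_4 vs v)
  then show ?thesis by blast
qed

text \<open>Otherwise at most three vectors span the range in dimension four, and a nonzero
  \<open>v\<close> orthogonal to all of them has \<open>qform \<rho> v = 0\<close>.\<close>

lemma dec4_nth_nonzero:
  assumes W: "W \<in> dec4 \<rho>" and pd: "\<And>v. v \<noteq> (\<lambda>_. 0) \<Longrightarrow> qform \<rho> v \<noteq> 0"
  shows "W $ s \<noteq> 0"
proof
  assume "W $ s = 0"
  define p :: "4 \<Rightarrow> bool \<times> bool" where "p i = (i = 3 \<or> i = 4, i = 2 \<or> i = 4)" for i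
  define A :: "complex^4^4" where "A = (\<chi> t i. W $ t $ fst (p i) $ snd (p i))"
  have "row s A = 0" using \<open>W $ s = 0\<close> by (simp add: row_def A_def vec_eq_iff)
  then have "det A = 0" by (rule det_zero_row)
  then have "\<not> invertible A" by (simp add: invertible_det_nz)
  then obtain x where x: "x \<noteq> 0" "A *v x = 0"
    by (metis invertible_left_inverse matrix_left_invertible_ker)
  define v where "v = (\<lambda>(a,b). cnj (x $ (if a then (if b then 4 else 3) else (if b then 2 else 1))))"
  have "v \<noteq> (\<lambda>_. 0)"
  proof
    assume "v = (\<lambda>_. 0)"
    then have "v (a,b) = 0" for a b by simp
    from this[of False False] this[of False True] this[of True False] this[of True True]
    have "x = 0" by (simp add: v_def vec_eq_iff forall_4)
    with x(1) show False ..
  qed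
  moreover have "(\<Sum>(a,b)\<in>UNIV. cnj (v (a,b)) * W $ t $ a $ b) = 0" for t
  proof -
    have "(A *v x) $ t = 0" using x by simp
    then show ?thesis by (simp add: matrix_vector_mult_def sum_4 A_def p_def v_def sum_bool_prod mult.commute)
  qed
  ultimately show False using pd qform_dec4[OF W, of v] by (simp add: split_def)
qed

lemma tr2_adj2_mult: "tr2 (adj2 A ** B) = polar A B"
  by (simp add: tr2_def polar_def cmat_mult_nth adj2_nth algebra_simps)

lemma polar_self: "polar A A = 2 * det2 A"
  by (simp add: polar_def det2_def)

lemma two_qubit_posdef:
  assumes ne: "dec4 \<rho> \<noteq> {}" and pd: "\<And>v. v \<noteq> (\<lambda>_. 0) \<Longrightarrow> qform \<rho> v \<noteq> 0"
  shows "\<exists>u N. u \<in> dec4 \<rho> \<and> dag N = N \<and> tr2 N = 0 \<and> det2 N = -1 \<and>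
    (\<Sum>s\<in>UNIV. 2 * cmod (det2 (u $ s)))\<^sup>2 \<le> - 4 * Re (det2 (cond_op \<rho> N))"
proof -
  obtain W and D :: "4 \<Rightarrow> real" where W: "W \<in> dec4 \<rho>" and D: "\<And>s. det2 (W $ s) = D s"
    and D0: "\<And>s. D s \<ge> 0" and ord: "D 1 \<ge> D 2" "D 2 \<ge> D 3" "D 3 \<ge> D 4"
    and o: "\<And>s t. s \<noteq> t \<Longrightarrow> polar (W $ s) (W $ t) = 0"
    by (rule takagi_dec4[OF ne]) blast
  have Dpos: "D s > 0" for s
  proof (rule ccontr)
    assume "\<not> D s > 0"
    then have "det2 (W $ s) = 0" using D0[of s] D[of s] by simp
    then have all: "polar (W $ s) (W $ t) = 0" for t
      using o[of s t] polar_self[of "W $ s"] by (cases "s = t") auto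
    \<comment> \<open>The spin flip of \<open>W $ s\<close>: its inner product with
      \<open>W $ t\<close> is \<open>polar (W $ s) (W $ t)\<close>, so it lies in the kernel of the
      form.\<close>
    define v where "v = (\<lambda>(a,b). cnj (adj2 (W $ s) $ b $ a))"
    have "(\<Sum>(a,b)\<in>UNIV. cnj (v (a,b)) * W $ t $ a $ b) = 0" for t
      using all[of t] by (simp add: sum_bool_prod v_def adj2_nth polar_def algebra_simps)
    then have "qform \<rho> v = 0" using qform_dec4[OF W, of v] by (simp add: split_def)
    then have "v = (\<lambda>_. 0)" using pd by blast
    then have "v (a,b) = 0" for a b by simp
    then have "adj2 (W $ s) $ b $ a = 0" for a b by (simp add: v_def)
    from this[of False False] this[of False True] this[of True False] this[of True True]
    have "W $ s = 0" by (simp add: cmat_eq_iff adj2_nth)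
    with dec4_nth_nonzero[OF W pd, of s] show False by blast
  qed
  \<comment> \<open>\<open>adj2 (W $ 1)\<close> is \<open>D 1\<close> times the inverse of
    \<open>W $ 1\<close>, and the scalar normalises the determinant to one. Orthogonality to
    \<open>W $ 1\<close> becomes tracelessness.\<close>
  define h where "h s = msc (1 / sqrt (D 1 * D s)) (adj2 (W $ 1) ** W $ s)" for s
  have sq: "(complex_of_real (1 / sqrt (D 1 * D s)))\<^sup>2 = of_real (1 / (D 1 * D s))" for s
    unfolding of_real_power[symmetric] using Dpos[of 1] Dpos[of s] by (simp add: power_divide)
  have trh: "tr2 (h s) = 0" if "s \<noteq> 1" for s
  proof -
    have "tr2 (h s) = (1 / sqrt (D 1 * D s)) * tr2 (adj2 (W $ 1) ** W $ s)"
      by (simp add: h_def tr2_def msc_nth add_divide_distrib)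
    then show ?thesis using o[of 1 s] that by (simp add: tr2_adj2_mult)
  qed
  have deth: "det2 (h s) = 1" for s
    using Dpos[of 1] Dpos[of s] unfolding h_def det2_msc det2_mult det2_adj2 D sq by simp
  have oh: "polar (h s) (h t) = 0" if "s \<noteq> t" for s t
    using o[OF that] by (simp add: h_def polar_msc polar_mult_left)
  have hW: "W $ s = msc (sqrt (D s / D 1)) (W $ 1 ** h s)" for s
  proof -
    have "sqrt (D s / D 1) * (1 / sqrt (D 1 * D s)) * D 1 = 1"
      using Dpos[of 1] Dpos[of s] by (simp add: real_sqrt_divide real_sqrt_mult)
    then have "complex_of_real (sqrt (D s / D 1)) * complex_of_real (1 / sqrt (D 1 * D s)) * complex_of_real (D 1) = 1"
      by (metis of_real_mult of_real_1)
    then show ?thesis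
      by (simp add: h_def msc_mult_right matrix_mul_assoc mult_adj2 msc_mult_left msc_msc D)
  qed
  obtain N and c d :: real where N: "dag N = N" "tr2 N = 0" "det2 N = -1" and cd: "c\<^sup>2 + d\<^sup>2 = 1"
    and form: "\<And>r1 r2 r3 r4 :: real. det2 (msc r1 N + msc r2 (h 2 ** N ** dag (h 2)) + msc r3 (h 3 ** N ** dag (h 3))
        + msc r4 (h 4 ** N ** dag (h 4))) = - complex_of_real ((r1+r2-r3-r4)\<^sup>2 * c\<^sup>2 + (r1-r2+r3-r4)\<^sup>2 * d\<^sup>2)"
    by (rule quaternion_form[of "h 2" "h 3" "h 4"]) (use trh deth oh in auto)
  have termW: "W $ s ** N ** dag (W $ s) = W $ 1 ** msc (D s / D 1) (h s ** N ** dag (h s)) ** dag (W $ 1)" for s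
  proof -
    have "complex_of_real (sqrt (D s / D 1)) * complex_of_real (sqrt (D s / D 1)) = of_real (D s / D 1)"
      using D0[of s] D0[of 1] by (simp flip: of_real_mult del: of_real_divide)
    then have "msc (sqrt (D s / D 1)) (W $ 1 ** h s) ** N ** dag (msc (sqrt (D s / D 1)) (W $ 1 ** h s))
       = W $ 1 ** msc (D s / D 1) (h s ** N ** dag (h s)) ** dag (W $ 1)"
      by (simp only: msc_mult_left msc_mult_right dag_msc dag_mult msc_msc cmat_assoc complex_cnj_complex_of_real)
    then show ?thesis using hW[of s] by simp
  qed
  \<comment> \<open>Factoring out \<open>W $ 1\<close> on both sides leaves the expression in
    \<open>form\<close> with weights D s / D 1.\<close>
  have "cond_op \<rho> N = W $ 1 ** (msc (complex_of_real 1) N + msc (complex_of_real (D 2 / D 1)) (h 2 ** N ** dag (h 2))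
      + msc (complex_of_real (D 3 / D 1)) (h 3 ** N ** dag (h 3))
      + msc (complex_of_real (D 4 / D 1)) (h 4 ** N ** dag (h 4))) ** dag (W $ 1)"
    unfolding cond_op_dec4[OF W] sum_4 cmat_mult_add cmat_add_mult
    using termW[of 2] termW[of 3] termW[of 4] by simp
  then have "det2 (cond_op \<rho> N) = D 1 * - complex_of_real ((1+D 2/D 1-D 3/D 1-D 4/D 1)\<^sup>2 * c\<^sup>2 + (1-D 2/D 1+D 3/D 1-D 4/D 1)\<^sup>2 * d\<^sup>2) * D 1"
    by (simp only: det2_mult det2_dag form D complex_cnj_complex_of_real)
  then have "Re (det2 (cond_op \<rho> N)) = - (D 1 * ((1+D 2/D 1-D 3/D 1-D 4/D 1)\<^sup>2 * c\<^sup>2 + (1-D 2/D 1+D 3/D 1-D 4/D 1)\<^sup>2 * d\<^sup>2) * D 1)"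
    by (simp only: of_real_mult[symmetric] of_real_minus[symmetric] Re_complex_of_real mult_minus_right mult_minus_left)
  also have "\<dots> = - ((D 1 * (1+D 2/D 1-D 3/D 1-D 4/D 1))\<^sup>2 * c\<^sup>2 + (D 1 * (1-D 2/D 1+D 3/D 1-D 4/D 1))\<^sup>2 * d\<^sup>2)"
    by (simp add: power_mult_distrib) (simp add: power2_eq_square algebra_simps)
  also have "D 1 * (1+D 2/D 1-D 3/D 1-D 4/D 1) = D 1 + D 2 - D 3 - D 4"
    using Dpos[of 1] by (simp add: field_simps)
  also have "D 1 * (1-D 2/D 1+D 3/D 1-D 4/D 1) = D 1 - D 2 + D 3 - D 4"
    using Dpos[of 1] by (simp add: field_simps)
  finally have detP: "- 4 * Re (det2 (cond_op \<rho> N)) = 4 * ((D 1 + D 2 - D 3 - D 4)\<^sup>2 * c\<^sup>2 + (D 1 - D 2 + D 3 - D 4)\<^sup>2 * d\<^sup>2)"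
    by simp
  \<comment> \<open>By the ordering, \<open>S\<close> is the smaller of the two nonnegative
    combinations, and c^2 + d^2 = 1 makes the bound a convex combination of their squares.\<close>
  define S where "S = D 1 - D 2 + D 3 - D 4"
  have "S \<ge> 0" "S \<le> D 1 + D 2 - D 3 - D 4" using ord by (auto simp: S_def)
  then have "S\<^sup>2 * c\<^sup>2 \<le> (D 1 + D 2 - D 3 - D 4)\<^sup>2 * c\<^sup>2" by (intro mult_right_mono power_mono) auto
  then have "S\<^sup>2 * (c\<^sup>2 + d\<^sup>2) \<le> (D 1 + D 2 - D 3 - D 4)\<^sup>2 * c\<^sup>2 + (D 1 - D 2 + D 3 - D 4)\<^sup>2 * d\<^sup>2"
    by (simp add: S_def algebra_simps)
  then have bound: "(2 * S)\<^sup>2 \<le> - 4 * Re (det2 (cond_op \<rho> N))"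
    unfolding detP cd by (simp add: power_mult_distrib)
  \<comment> \<open>With y = i x the mixed vectors have determinants (D 1 - D 2)/2 and its negative,
    and likewise for 3 and 4, so the doubled moduli add up to 2 S.\<close>
  define x where "x = complex_of_real (1 / sqrt 2)"
  define y where "y = \<i> * complex_of_real (1 / sqrt 2)"
  have "x * cnj x + y * cnj y = 1" and x2: "x\<^sup>2 = 1/2" "y\<^sup>2 = -1/2"
    by (simp_all add: x_def y_def power_mult_distrib power_divide flip: of_real_power of_real_mult)
  then have xy: "x * cnj x + y * cnj y = 1" by blast
  have x2': "(cnj x)\<^sup>2 = 1/2" "(cnj y)\<^sup>2 = -1/2" by (simp_all add: x2 flip: complex_cnj_power)
  define u where "u = rotate2 3 4 x y (rotate2 1 2 x y W)"
  have u: "u \<in> dec4 \<rho>" unfolding u_def by (intro rotate2_dec4 W xy) auto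
  have nth: "rotate2 1 2 x y W $ 3 = W $ 3" "rotate2 1 2 x y W $ 4 = W $ 4"
    "u $ 1 = rotate2 1 2 x y W $ 1" "u $ 2 = rotate2 1 2 x y W $ 2"
    unfolding u_def by (simp_all add: rotate2_nth)
  have ne: "(1 :: 4) \<noteq> 2" "(3 :: 4) \<noteq> 4" by simp_all
  have "det2 (u $ 1) = of_real ((D 1 - D 2) / 2)" "det2 (u $ 2) = of_real (- (D 1 - D 2) / 2)"
    unfolding nth rotate2_nth(1,2)[OF ne(1)] det2_lincomb o[OF ne(1)] D
    by (simp_all add: x2 x2' diff_divide_distrib)
  moreover have "det2 (u $ 3) = of_real ((D 3 - D 4) / 2)" "det2 (u $ 4) = of_real (- (D 3 - D 4) / 2)"
    unfolding u_def nth rotate2_nth(1,2)[OF ne(2)] det2_lincomb o[OF ne(2)] D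
    by (simp_all add: x2 x2' diff_divide_distrib)
  ultimately have "(\<Sum>s\<in>UNIV. 2 * cmod (det2 (u $ s))) = 2 * S"
    unfolding sum_4 using ord by (simp only: norm_of_real) (simp add: S_def)
  then show ?thesis using u N bound by (intro exI[of _ u] exI[of _ N]) simp
qed

text \<open>Adding 1/(k+1) times the identity makes the operator definite. The decompositions and
  the matrices \<open>N\<close> stay bounded, and every condition is closed, so a convergent
  subsequence yields the claim. Stating the bound for a decomposition \<open>u\<close> makes its
  left side continuous.\<close>

lemma two_qubit:
  assumes herm: "\<And>x y. \<rho> x y = cnj (\<rho> y x)" and psd: "\<And>v. 0 \<le> Re (qform \<rho> v)"
  obtains u N where "u \<in> dec4 \<rho>" "dag N = N" "tr2 N = 0" "det2 N = -1"
    "(\<Sum>s\<in>UNIV. 2 * cmod (det2 (u $ s)))\<^sup>2 \<le> - 4 * Re (det2 (cond_op \<rho> N))"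
proof -
  define \<rho>k where "\<rho>k k x y = \<rho> x y + of_real (if x = y then inverse (real (Suc k)) else 0)" for k x y
  have ex: "\<exists>u N. u \<in> dec4 (\<rho>k k) \<and> dag N = N \<and> tr2 N = 0 \<and> det2 N = -1 \<and>
    (\<Sum>s\<in>UNIV. 2 * cmod (det2 (u $ s)))\<^sup>2 \<le> - 4 * Re (det2 (cond_op (\<rho>k k) N))" for k
  proof (rule two_qubit_posdef)
    have q: "Re (qform (\<rho>k k) v) = Re (qform \<rho> v) + inverse (real (Suc k)) * (\<Sum>x\<in>UNIV. (cmod (v x))\<^sup>2)" for v
    proof -
      have "cnj (v x) * \<rho>k k x y * v y = cnj (v x) * \<rho> x y * v y
          + (if x = y then of_real (inverse (real (Suc k)) * (cmod (v x))\<^sup>2) else 0)" for x y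
        by (simp add: \<rho>k_def distrib_left distrib_right mult.assoc mult.left_commute cnj_mult_self)
      then have "qform (\<rho>k k) v = qform \<rho> v + of_real (\<Sum>x\<in>UNIV. inverse (real (Suc k)) * (cmod (v x))\<^sup>2)"
        by (simp add: qform_def sum.distrib)
      then show ?thesis by (simp only: plus_complex.simps Re_complex_of_real sum_distrib_left)
    qed
    have "0 \<le> inverse (real (Suc k)) * (\<Sum>x\<in>UNIV. (cmod (v x))\<^sup>2)" for v :: "bool \<times> bool \<Rightarrow> complex"
      by (intro mult_nonneg_nonneg sum_nonneg) auto
    then have "0 \<le> Re (qform (\<rho>k k) v)" for v unfolding q using psd by (intro add_nonneg_nonneg)
    moreover have "\<rho>k k x y = cnj (\<rho>k k y x)" for x y unfolding \<rho>k_def by (subst herm) auto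
    ultimately show "dec4 (\<rho>k k) \<noteq> {}" by (intro dec4_nonempty)
    show "qform (\<rho>k k) v \<noteq> 0" if "v \<noteq> (\<lambda>_. 0)" for v
    proof -
      from that obtain x where "v x \<noteq> 0" by metis
      then have "0 < (\<Sum>x\<in>UNIV. (cmod (v x))\<^sup>2)" by (intro sum_pos2[of _ x]) auto
      then have "0 < Re (qform (\<rho>k k) v)" unfolding q using psd[of v] by (intro add_nonneg_pos mult_pos_pos) auto
      then show ?thesis by auto
    qed
  qed
  then obtain u N where u: "\<And>k. u k \<in> dec4 (\<rho>k k)"
    and N: "\<And>k. dag (N k) = N k" "\<And>k. tr2 (N k) = 0" "\<And>k. det2 (N k) = -1"
    and b: "\<And>k. (\<Sum>s\<in>UNIV. 2 * cmod (det2 (u k $ s)))\<^sup>2 \<le> - 4 * Re (det2 (cond_op (\<rho>k k) (N k)))"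
    by metis
  \<comment> \<open>The added 1 absorbs the perturbation for every \<open>k\<close>, so one ball
    contains all \<open>u k\<close>.\<close>
  define K where "K = (\<Sum>s\<in>(UNIV::4 set). \<Sum>a\<in>UNIV. \<Sum>b\<in>UNIV. sqrt (cmod (\<rho> (a,b) (a,b)) + 1))"
  have uK: "norm (u k) \<le> K" for k
    unfolding K_def
  proof (intro order.trans[OF norm_dec4_le[OF u]] sum_mono real_sqrt_le_mono)
    fix a b
    have "cmod (\<rho>k k (a,b) (a,b)) \<le> cmod (\<rho> (a,b) (a,b)) + cmod (of_real (inverse (real (Suc k))))"
      unfolding \<rho>k_def by (simp only: if_True refl norm_triangle_ineq)
    also have "cmod (of_real (inverse (real (Suc k)))) \<le> 1"
      unfolding norm_of_real by (simp add: inverse_le_1_iff)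
    finally show "cmod (\<rho>k k (a,b) (a,b)) \<le> cmod (\<rho> (a,b) (a,b)) + 1" by simp
  qed
  have NK: "norm (N k) \<le> 4" for k
  proof -
    note h = traceless_hermitian[OF N(1,2)[of k]]
    have "complex_of_real ((Re (N k $ False $ False))\<^sup>2 + (cmod (N k $ False $ True))\<^sup>2) = 1"
      using h(4) N(3)[of k] by (metis neg_equal_iff_equal)
    then have eq: "(Re (N k $ False $ False))\<^sup>2 + (cmod (N k $ False $ True))\<^sup>2 = 1"
      by (simp only: of_real_eq_1_iff)
    have "(Re (N k $ False $ False))\<^sup>2 \<le> 1" "(cmod (N k $ False $ True))\<^sup>2 \<le> 1"
      using eq zero_le_power2[of "Re (N k $ False $ False)"] zero_le_power2[of "cmod (N k $ False $ True)"]
      by linarith+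
    then have "\<bar>Re (N k $ False $ False)\<bar> \<le> 1" "cmod (N k $ False $ True) \<le> 1"
      by (simp_all add: abs_square_le_1)
    then have e: "cmod (N k $ i $ j) \<le> 1" for i j
      using h by (cases i; cases j) (simp_all add: cmod_def)
    have "norm (N k $ i) \<le> (\<Sum>j\<in>(UNIV::bool set). 1)" for i
      unfolding norm_vec_def using e by (intro order.trans[OF L2_set_le_sum] sum_mono) auto
    then have "norm (N k) \<le> (\<Sum>i\<in>(UNIV::bool set). 2)"
      unfolding norm_vec_def[of "N k"] by (intro order.trans[OF L2_set_le_sum] sum_mono) auto
    then show ?thesis by simp
  qed
  have "compact (cball (0 :: cmat^4) K \<times> cball (0 :: cmat) 4)" by (intro compact_Times compact_cball)
  then have sc: "seq_compact (cball (0 :: cmat^4) K \<times> cball (0 :: cmat) 4)"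
    by (simp only: compact_eq_seq_compact_metric)
  have "\<forall>k. (u k, N k) \<in> cball 0 K \<times> cball 0 4" using uK NK by simp
  then obtain l r where r: "strict_mono r" and lim: "((\<lambda>k. (u k, N k)) \<circ> r) \<longlonglongrightarrow> l"
    using sc[unfolded seq_compact_def, THEN spec, of "\<lambda>k. (u k, N k)"] by blast
  define U where "U = fst l"
  define M where "M = snd l"
  have U: "(\<lambda>k. u (r k)) \<longlonglongrightarrow> U" and M: "(\<lambda>k. N (r k)) \<longlonglongrightarrow> M"
    using tendsto_fst[OF lim] tendsto_snd[OF lim] by (simp_all add: U_def M_def comp_def)
  have \<rho>lim: "(\<lambda>k. \<rho>k (r k) x y) \<longlonglongrightarrow> \<rho> x y" for x y
  proof -
    have "(\<lambda>k. inverse (real (Suc (r k)))) \<longlonglongrightarrow> 0"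
      using LIMSEQ_subseq_LIMSEQ[OF LIMSEQ_inverse_real_of_nat r] by (simp add: comp_def)
    then have "(\<lambda>k. if x = y then inverse (real (Suc (r k))) else 0) \<longlonglongrightarrow> 0"
      by (cases "x = y") (simp_all del: of_nat_Suc)
    from tendsto_add[OF tendsto_const tendsto_of_real[OF this], of "\<rho> x y"]
    show ?thesis by (simp add: \<rho>k_def)
  qed
  note Mlim = tendsto_vec_nth[OF tendsto_vec_nth[OF M]]
  show ?thesis
  proof (rule that)
    show "U \<in> dec4 \<rho>" unfolding dec4_def
    proof (intro CollectI allI)
      fix a b c d
      have "(\<lambda>k. \<Sum>s\<in>UNIV. u (r k) $ s $ a $ b * cnj (u (r k) $ s $ c $ d)) \<longlonglongrightarrow> (\<Sum>s\<in>UNIV. U $ s $ a $ b * cnj (U $ s $ c $ d))"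
        by (intro tendsto_intros U)
      moreover have "(\<Sum>s\<in>UNIV. u (r k) $ s $ a $ b * cnj (u (r k) $ s $ c $ d)) = \<rho>k (r k) (a,b) (c,d)" for k
        using u[of "r k"] by (simp add: dec4_def)
      ultimately show "(\<Sum>s\<in>UNIV. U $ s $ a $ b * cnj (U $ s $ c $ d)) = \<rho> (a,b) (c,d)"
        using \<rho>lim[of "(a,b)" "(c,d)"] by (simp add: LIMSEQ_unique)
    qed
    have "cnj (M $ j $ i) = M $ i $ j" for i j
    proof -
      have "(\<lambda>k. cnj (N (r k) $ j $ i)) \<longlonglongrightarrow> cnj (M $ j $ i)" by (intro tendsto_intros M)
      moreover have "cnj (N (r k) $ j $ i) = N (r k) $ i $ j" for k by (metis N(1) dag_nth)
      ultimately show ?thesis using Mlim[of i j] by (simp add: LIMSEQ_unique)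
    qed
    then show "dag M = M" unfolding vec_eq_iff dag_nth by blast
    have "(\<lambda>k. tr2 (N (r k))) \<longlonglongrightarrow> tr2 M" unfolding tr2_def by (intro tendsto_intros M)
    then show "tr2 M = 0" unfolding N by (simp add: LIMSEQ_const_iff)
    have "(\<lambda>k. det2 (N (r k))) \<longlonglongrightarrow> det2 M" unfolding det2_def by (intro tendsto_intros M)
    then show "det2 M = -1" unfolding N by (simp add: LIMSEQ_const_iff)
    have "(\<lambda>k. (\<Sum>s\<in>UNIV. 2 * cmod (det2 (u (r k) $ s)))\<^sup>2) \<longlonglongrightarrow> (\<Sum>s\<in>UNIV. 2 * cmod (det2 (U $ s)))\<^sup>2"
      unfolding det2_def by (intro tendsto_intros U)
    moreover have "(\<lambda>k. - 4 * Re (det2 (cond_op (\<rho>k (r k)) (N (r k))))) \<longlonglongrightarrow> - 4 * Re (det2 (cond_op \<rho> M))"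
      unfolding det2_def cond_op_def vec_lambda_beta by (intro tendsto_intros M \<rho>lim)
    ultimately show "(\<Sum>s\<in>UNIV. 2 * cmod (det2 (U $ s)))\<^sup>2 \<le> - 4 * Re (det2 (cond_op \<rho> M))"
      by (rule LIMSEQ_le) (use b in auto)
  qed
qed

section \<open>Monogamy\<close>

text \<open>The reduced state of the vector with coefficient matrix \<open>u\<close> is
  \<open>u ** dag u\<close>.\<close>

lemma cvec_two_qubit:
  assumes "b \<noteq> 0"
  shows "cvec {b} (\<lambda>x. u $ x 0 $ x b) = 2 * cmod (det2 u)"
proof -
  have "gmat {b} (\<lambda>x. u $ x 0 $ x b) = u ** dag u"
    unfolding gmat_def vec_eq_iff
    using assms by (auto simp: cmat_mult_nth dag_nth sum_configs_single)
  then have "Re (det2 (gmat {b} (\<lambda>x. u $ x 0 $ x b))) = (cmod (det2 u))\<^sup>2"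
    by (simp add: det2_mult det2_dag flip: complex_norm_square)
  then show ?thesis by (simp add: cvec_def)
qed

text \<open>Explicit decompositions instead of infima: these can be concatenated over the vectors of
  an ensemble.\<close>

lemma monogamy_pure:
  assumes "b \<noteq> 0" "0 \<notin> R" "b \<notin> R" "finite R"
  defines "S \<equiv> insert 0 (insert b R)"
  shows "\<exists>us ts. decomp {0,b} (reduced S {0,b} (\<lambda>x y. v x * cnj (v y))) us \<and>
    decomp (insert 0 R) (reduced S (insert 0 R) (\<lambda>x y. v x * cnj (v y))) ts \<and>
    (\<Sum>u\<leftarrow>us. cvec {b} u)\<^sup>2 + (\<Sum>t\<leftarrow>ts. cvec R t)\<^sup>2 \<le> (cvec (insert b R) v)\<^sup>2"
proof -
  define f where "f p z = v (z(0 := fst p, b := snd p))" for p z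
  define \<rho> where "\<rho> p q = (\<Sum>z\<in>configs R. f p z * cnj (f q z))" for p q
  have herm: "\<rho> p q = cnj (\<rho> q p)" for p q by (simp add: \<rho>_def mult.commute)
  have psd: "0 \<le> Re (qform \<rho> x)" for x
  proof -
    have "qform \<rho> x = (\<Sum>z\<in>configs R. \<Sum>p\<in>UNIV. \<Sum>q\<in>UNIV. (cnj (x p) * f p z) * cnj (cnj (x q) * f q z))"
      unfolding qform_def \<rho>_def sum_distrib_left sum_distrib_right
      by (subst sum.swap[of _ "configs R"], subst sum.swap[of _ "configs R"]) (simp add: mult_ac)
    also have "\<dots> = (\<Sum>z\<in>configs R. of_real ((cmod (\<Sum>p\<in>UNIV. cnj (x p) * f p z))\<^sup>2))"
      unfolding complex_norm_square cnj_sum sum_product ..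
    finally show ?thesis by (simp add: sum_nonneg flip: of_real_power)
  qed
  obtain u N where u: "u \<in> dec4 \<rho>" and N: "dag N = N" "tr2 N = 0" "det2 N = -1"
    and bnd: "(\<Sum>s\<in>UNIV. 2 * cmod (det2 (u $ s)))\<^sup>2 \<le> - 4 * Re (det2 (cond_op \<rho> N))"
    using two_qubit[of \<rho>, OF herm psd] by metis
  obtain \<beta> \<gamma> where n1: "(cmod \<beta>)\<^sup>2 + (cmod \<gamma>)\<^sup>2 = 1" and Nn: "N $ False $ False = \<beta> * cnj \<beta> - \<gamma> * cnj \<gamma>"
    "N $ False $ True = 2 * \<beta> * cnj \<gamma>" "N $ True $ False = 2 * cnj \<beta> * \<gamma>" "N $ True $ True = \<gamma> * cnj \<gamma> - \<beta> * cnj \<beta>"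
    using spinor[OF N] by metis
  have n1': "\<beta> * cnj \<beta> + \<gamma> * cnj \<gamma> = 1"
    using n1 by (metis complex_norm_square of_real_add of_real_1)
  define us where "us = map (\<lambda>s x. u $ s $ x 0 $ x b) [1,2,3,4]"
  \<comment> \<open>\<open>t0\<close> and \<open>t1\<close> are the vectors left on A and R when B
    is measured in the eigenbasis of the transpose of \<open>N\<close>.\<close>
  define t0 where "t0 x = \<beta> * v (x(b := False)) + \<gamma> * v (x(b := True))" for x
  define t1 where "t1 x = - cnj \<gamma> * v (x(b := False)) + cnj \<beta> * v (x(b := True))" for x
  have "decomp {0,b} (reduced S {0,b} (\<lambda>x y. v x * cnj (v y))) us"
    unfolding decomp_def
  proof (intro ballI)
    fix x y assume xy: "x \<in> configs {0,b}" "y \<in> configs {0,b}"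
    have SR: "S - {0,b} = R" using assms by auto
    have m: "merge {0,b} x z = z(0 := x 0, b := x b)" if "z \<in> configs R" for x z
      using assms that by (auto simp: merge_def fun_eq_iff)
    have "reduced S {0,b} (\<lambda>x y. v x * cnj (v y)) x y = \<rho> (x 0, x b) (y 0, y b)"
      unfolding reduced_def SR \<rho>_def f_def by (intro sum.cong) (auto simp: m)
    also have "\<dots> = (\<Sum>s\<in>UNIV. u $ s $ x 0 $ x b * cnj (u $ s $ y 0 $ y b))"
      using u by (simp add: dec4_def)
    also have "\<dots> = (\<Sum>v\<leftarrow>us. v x * cnj (v y))" by (simp add: us_def sum_4 add.assoc)
    finally show "reduced S {0,b} (\<lambda>x y. v x * cnj (v y)) x y = (\<Sum>v\<leftarrow>us. v x * cnj (v y))" .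
  qed
  moreover have "decomp (insert 0 R) (reduced S (insert 0 R) (\<lambda>x y. v x * cnj (v y))) [t0, t1]"
    unfolding decomp_def
  proof (intro ballI)
    fix x y assume xy: "x \<in> configs (insert 0 R)" "y \<in> configs (insert 0 R)"
    have SR: "S - insert 0 R = {b}" using assms by auto
    have m: "merge (insert 0 R) x z = x(b := z b)" if "x \<in> configs (insert 0 R)" "z \<in> configs {b}" for x z
      using assms that by (auto simp: merge_def fun_eq_iff configs_def)
    have "reduced S (insert 0 R) (\<lambda>x y. v x * cnj (v y)) x y
        = (\<Sum>z\<in>configs {b}. v (x(b := z b)) * cnj (v (y(b := z b))))"
      unfolding reduced_def SR by (intro sum.cong) (auto simp: m xy)
    also have "\<dots> = v (x(b := False)) * cnj (v (y(b := False))) + v (x(b := True)) * cnj (v (y(b := True)))"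
      by (simp add: sum_configs_single)
    also have "\<dots> = (\<beta> * cnj \<beta> + \<gamma> * cnj \<gamma>) * (v (x(b := False)) * cnj (v (y(b := False))) + v (x(b := True)) * cnj (v (y(b := True))))"
      unfolding n1' by simp
    also have "\<dots> = (\<Sum>t\<leftarrow>[t0,t1]. t x * cnj (t y))"
      by (simp add: t0_def t1_def algebra_simps)
    finally show "reduced S (insert 0 R) (\<lambda>x y. v x * cnj (v y)) x y = (\<Sum>t\<leftarrow>[t0,t1]. t x * cnj (t y))" .
  qed
  moreover have "(\<Sum>u\<leftarrow>us. cvec {b} u)\<^sup>2 + (\<Sum>t\<leftarrow>[t0,t1]. cvec R t)\<^sup>2 \<le> (cvec (insert b R) v)\<^sup>2"
  proof -
    have usum: "(\<Sum>u\<leftarrow>us. cvec {b} u) = (\<Sum>s\<in>UNIV. 2 * cmod (det2 (u $ s)))"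
      by (simp add: us_def sum_4 cvec_two_qubit[OF assms(1)])
    have tf: "t0 (z(0 := a)) = \<beta> * f (a,False) z + \<gamma> * f (a,True) z"
       "t1 (z(0 := a)) = - cnj \<gamma> * f (a,False) z + cnj \<beta> * f (a,True) z" for z a
      by (simp_all add: t0_def t1_def f_def)
    have plus: "gmat R t0 + gmat R t1 = gmat (insert b R) v"
    proof -
      have "gmat (insert b R) v $ a $ c = (\<Sum>z\<in>configs R. f (a,False) z * cnj (f (c,False) z) + f (a,True) z * cnj (f (c,True) z))" for a c
        unfolding gmat_nth sum_configs_insert[OF assms(3,4)] f_def sum.distrib
        using assms(1) by (simp add: fun_upd_twist)
      also have "\<dots> a c = (\<Sum>z\<in>configs R. (\<beta> * cnj \<beta> + \<gamma> * cnj \<gamma>) * (f (a,False) z * cnj (f (c,False) z) + f (a,True) z * cnj (f (c,True) z)))" for a c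
        unfolding n1' by simp
      also have "\<dots> a c = (gmat R t0 + gmat R t1) $ a $ c" for a c
        unfolding vector_add_component gmat_nth tf sum.distrib[symmetric]
        by (intro sum.cong) (simp_all add: algebra_simps)
      finally show ?thesis by (simp add: vec_eq_iff)
    qed
    have minus: "gmat R t0 - gmat R t1 = cond_op \<rho> N"
    proof -
      have "(gmat R t0 - gmat R t1) $ a $ c = cond_op \<rho> N $ a $ c" for a c
        unfolding vector_minus_component gmat_nth tf cond_op_def vec_lambda_beta \<rho>_def sum_subtractf[symmetric]
        by (simp add: UNIV_bool sum_distrib_left Nn sum.distrib[symmetric])
           (intro sum.cong; simp add: algebra_simps)
      then show ?thesis by (simp add: vec_eq_iff)
    qed
    \<comment> \<open>The determinant is a quadratic form on two-by-two matrices, so the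
      parallelogram law holds.\<close>
    have par: "det2 (A + B) + det2 (A - B) = 2 * det2 A + 2 * det2 B" for A B
      by (simp add: det2_def algebra_simps)
    have "(\<Sum>t\<leftarrow>[t0,t1]. cvec R t)\<^sup>2 \<le> 2 * (cvec R t0)\<^sup>2 + 2 * (cvec R t1)\<^sup>2"
      using zero_le_power2[of "cvec R t0 - cvec R t1"] by (simp add: power2_sum power2_diff)
    also have "\<dots> = 4 * Re (2 * det2 (gmat R t0) + 2 * det2 (gmat R t1))" by (simp add: cvec_sq)
    also have "\<dots> = 4 * Re (det2 (gmat (insert b R) v)) + 4 * Re (det2 (cond_op \<rho> N))"
      unfolding par[symmetric] plus minus by simp
    finally show ?thesis using bnd unfolding usum cvec_sq by linarith
  qed
  ultimately show ?thesis by blast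
qed

text \<open>For every decomposition of \<rho>, the pure case bounds each vector and Minkowski's
  inequality adds the bounds; then the infimum is taken.\<close>

lemma monogamy:
  assumes b: "b \<noteq> 0" and R: "0 \<notin> R" "b \<notin> R" "finite R"
    and d: "decomp (insert 0 (insert b R)) \<rho> ws"
  shows "(conc {0} {b} (reduced (insert 0 (insert b R)) {0,b} \<rho>))\<^sup>2
    + (conc {0} R (reduced (insert 0 (insert b R)) (insert 0 R) \<rho>))\<^sup>2 \<le> (conc {0} (insert b R) \<rho>)\<^sup>2"
proof -
  let ?S = "insert 0 (insert b R)"
  let ?AB = "conc {0} {b} (reduced ?S {0,b} \<rho>)"
  let ?AR = "conc {0} R (reduced ?S (insert 0 R) \<rho>)"
  have fin: "finite ?S" using R by simp
  have nAB: "0 \<le> ?AB"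
    using decomp_reduced_exists[OF _ fin d, of "{0,b}"] conc_nonneg[of "{b}"] b by auto
  have nAR: "0 \<le> ?AR"
    using decomp_reduced_exists[OF _ fin d, of "insert 0 R"] conc_nonneg[of R] R by blast
  have le: "sqrt (?AB\<^sup>2 + ?AR\<^sup>2) \<le> (\<Sum>v\<leftarrow>vs. cvec (insert b R) v)" if vs: "decomp ?S \<rho> vs" for vs
  proof -
    obtain us ts where us: "\<And>v. decomp {0,b} (reduced ?S {0,b} (\<lambda>x y. v x * cnj (v y))) (us v)"
      and ts: "\<And>v. decomp (insert 0 R) (reduced ?S (insert 0 R) (\<lambda>x y. v x * cnj (v y))) (ts v)"
      and c: "\<And>v. (\<Sum>u\<leftarrow>us v. cvec {b} u)\<^sup>2 + (\<Sum>t\<leftarrow>ts v. cvec R t)\<^sup>2 \<le> (cvec (insert b R) v)\<^sup>2"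
      using monogamy_pure[OF b R] by metis
    have cc: "(\<Sum>u\<leftarrow>concat (map g vs). h u) = (\<Sum>v\<leftarrow>vs. \<Sum>u\<leftarrow>g v. h u)" for g and h :: "((nat \<Rightarrow> bool) \<Rightarrow> complex) \<Rightarrow> real"
      by (induction vs) auto
    have "?AB \<le> (\<Sum>u\<leftarrow>concat (map us vs). cvec {b} u)"
      using b by (intro conc_le decomp_reduced vs us) auto
    moreover have "?AR \<le> (\<Sum>t\<leftarrow>concat (map ts vs). cvec R t)"
      using R by (intro conc_le decomp_reduced vs ts) auto
    ultimately have "?AB\<^sup>2 + ?AR\<^sup>2 \<le> (\<Sum>v\<leftarrow>vs. \<Sum>u\<leftarrow>us v. cvec {b} u)\<^sup>2 + (\<Sum>v\<leftarrow>vs. \<Sum>t\<leftarrow>ts v. cvec R t)\<^sup>2"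
      unfolding cc using nAB nAR by (intro add_mono power_mono)
    then have "sqrt (?AB\<^sup>2 + ?AR\<^sup>2) \<le> sqrt ((\<Sum>v\<leftarrow>vs. \<Sum>u\<leftarrow>us v. cvec {b} u)\<^sup>2 + (\<Sum>v\<leftarrow>vs. \<Sum>t\<leftarrow>ts v. cvec R t)\<^sup>2)"
      by (rule real_sqrt_le_mono)
    also have "\<dots> \<le> (\<Sum>v\<leftarrow>vs. cvec (insert b R) v)"
      by (rule minkowski_list) (use c cvec_nonneg in auto)
    finally show ?thesis .
  qed
  have "sqrt (?AB\<^sup>2 + ?AR\<^sup>2) \<le> conc {0} (insert b R) \<rho>"
    using b R by (intro conc_greatest[OF _ _ d] le) auto
  then have "(sqrt (?AB\<^sup>2 + ?AR\<^sup>2))\<^sup>2 \<le> (conc {0} (insert b R) \<rho>)\<^sup>2"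
    by (intro power_mono) auto
  then show ?thesis by simp
qed

section \<open>From monogamy to inequalities between powers\<close>

text \<open>Qubit A_i has index i - 1, so \<open>S\<close> consists of A_1 and A_i, ..., A_n.
  Monogamy is applied to the reduced state on \<open>S\<close>, whose marginals are those of \<rho>
  by \<open>reduced_reduced\<close>.\<close>

lemma C_rest_monogamy:
  assumes state: "is_state {0..<n} \<rho>" and i: "2 \<le> i" "i \<le> n - 1"
  shows "0 \<le> C_pair n \<rho> i" "0 \<le> C_rest n \<rho> i" "0 \<le> C_rest n \<rho> (i - 1)"
    "(C_pair n \<rho> i)\<^sup>2 + (C_rest n \<rho> i)\<^sup>2 \<le> (C_rest n \<rho> (i - 1))\<^sup>2"
proof -
  obtain vs where vs: "decomp {0..<n} \<rho> vs" using is_state_decomp[OF state] by auto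
  define S where "S = insert 0 (insert (i - 1) {i..<n})"
  have S: "S \<subseteq> {0..<n}" "finite S" using i by (auto simp: S_def)
  have eq: "{i - 1..<n} = insert (i - 1) {i..<n}" using i by auto
  obtain ws where ws: "decomp S (reduced {0..<n} S \<rho>) ws"
    using decomp_reduced_exists[OF S(1) _ vs] by auto
  have rr: "reduced S T (reduced {0..<n} S \<rho>) = reduced {0..<n} T \<rho>" if "T \<subseteq> S" for T
    using reduced_reduced[OF that S(1)] .
  have pair: "C_pair n \<rho> i = conc {0} {i - 1} (reduced S {0, i - 1} (reduced {0..<n} S \<rho>))"
    by (subst rr) (auto simp: C_pair_def S_def)
  have rest: "C_rest n \<rho> i = conc {0} {i..<n} (reduced S (insert 0 {i..<n}) (reduced {0..<n} S \<rho>))"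
    by (subst rr) (auto simp: C_rest_def S_def)
  have rest': "C_rest n \<rho> (i - 1) = conc {0} (insert (i - 1) {i..<n}) (reduced {0..<n} S \<rho>)"
    unfolding C_rest_def eq S_def ..
  show "(C_pair n \<rho> i)\<^sup>2 + (C_rest n \<rho> i)\<^sup>2 \<le> (C_rest n \<rho> (i - 1))\<^sup>2"
    unfolding pair rest rest' S_def
    by (rule monogamy[OF _ _ _ _ ws[unfolded S_def]]) (use i in auto)
  show "0 \<le> C_rest n \<rho> (i - 1)" unfolding rest'
    using conc_nonneg[of "insert (i - 1) {i..<n}"] ws i by (auto simp: S_def)
  obtain us where "decomp {0, i - 1} (reduced S {0, i - 1} (reduced {0..<n} S \<rho>)) us"
    using decomp_reduced_exists[of "{0, i - 1}", OF _ S(2) ws] by (auto simp: S_def)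
  then show "0 \<le> C_pair n \<rho> i" unfolding pair using conc_nonneg[of "{i - 1}"] i by auto
  obtain ts where "decomp (insert 0 {i..<n}) (reduced S (insert 0 {i..<n}) (reduced {0..<n} S \<rho>)) ts"
    using decomp_reduced_exists[of "insert 0 {i..<n}", OF _ S(2) ws] by (auto simp: S_def)
  then show "0 \<le> C_rest n \<rho> i" unfolding rest using conc_nonneg[of "{i..<n}"] i by auto
qed

text \<open>\<open>powr_split\<close> with exponent \<alpha>/r, applied to r-th powers; the
  hypothesis decides which of the two concurrences is the dominant part.\<close>

lemma C_rest_powr_step:
  fixes k p r \<alpha> :: real
  assumes state: "is_state {0..<n} \<rho>" and i: "2 \<le> i" "i \<le> n - 1"
    and k: "1 \<le> k" and p: "1/2 \<le> p" "p \<le> 1" and r: "2 \<le> r" and \<alpha>: "0 \<le> \<alpha>" "\<alpha> \<le> r / 2"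
  defines "l \<equiv> ((1 + k) powr (\<alpha> / r) - p powr (\<alpha> / r)) / k powr (\<alpha> / r)"
  shows "k * C_pair n \<rho> i powr r \<le> C_rest n \<rho> i powr r \<Longrightarrow>
      p powr (\<alpha> / r) * C_pair n \<rho> i powr \<alpha> + l * C_rest n \<rho> i powr \<alpha> \<le> C_rest n \<rho> (i - 1) powr \<alpha>"
    and "k * C_rest n \<rho> i powr r \<le> C_pair n \<rho> i powr r \<Longrightarrow>
      l * C_pair n \<rho> i powr \<alpha> + p powr (\<alpha> / r) * C_rest n \<rho> i powr \<alpha> \<le> C_rest n \<rho> (i - 1) powr \<alpha>"
proof -
  have x: "0 \<le> \<alpha> / r" "\<alpha> / r \<le> 1/2" using \<alpha> r by (simp_all add: divide_le_eq)
  have \<alpha>r: "(y powr r) powr (\<alpha> / r) = y powr \<alpha>" for y using r by (simp add: powr_powr)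
  have sum: "C_pair n \<rho> i powr r + C_rest n \<rho> i powr r \<le> C_rest n \<rho> (i - 1) powr r"
    using C_rest_monogamy[OF state i] r by (intro powr_add_le_of_squares) auto
  show "p powr (\<alpha> / r) * C_pair n \<rho> i powr \<alpha> + l * C_rest n \<rho> i powr \<alpha> \<le> C_rest n \<rho> (i - 1) powr \<alpha>"
    if "k * C_pair n \<rho> i powr r \<le> C_rest n \<rho> i powr r"
    using powr_split[OF x p k _ _ that, of "C_rest n \<rho> (i - 1) powr r"] sum
    by (simp add: \<alpha>r l_def)
  show "l * C_pair n \<rho> i powr \<alpha> + p powr (\<alpha> / r) * C_rest n \<rho> i powr \<alpha> \<le> C_rest n \<rho> (i - 1) powr \<alpha>"
    if "k * C_rest n \<rho> i powr r \<le> C_pair n \<rho> i powr r"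
    using powr_split[OF x p k _ _ that, of "C_rest n \<rho> (i - 1) powr r"] sum
    by (simp add: \<alpha>r l_def)
qed

theorem theorem2:
  fixes n m :: nat and k p r \<alpha> :: real
    and \<rho> :: "(nat \<Rightarrow> bool) \<Rightarrow> (nat \<Rightarrow> bool) \<Rightarrow> complex"
  assumes state: "is_state {0..<n} \<rho>"
    and n3: "n \<ge> 3"
    and k: "k \<ge> 1" and p: "1/2 \<le> p" "p \<le> 1" and r: "r \<ge> 2"
    and \<alpha>: "0 \<le> \<alpha>" "\<alpha> \<le> r / 2"
  defines "l \<equiv> ((1 + k) powr (\<alpha> / r) - p powr (\<alpha> / r)) / k powr (\<alpha> / r)"
  shows
   "(4 \<le> n \<and> 2 \<le> m \<and> m \<le> n - 2 \<and>
      (\<forall>i\<in>{2..m}. k * C_pair n \<rho> i powr r \<le> C_rest n \<rho> i powr r) \<and>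
      (\<forall>j\<in>{m+1..n-1}. C_pair n \<rho> j powr r \<ge> k * C_rest n \<rho> j powr r)
    \<longrightarrow> C_rest n \<rho> 1 powr \<alpha> \<ge>
          p powr (\<alpha> / r) * (\<Sum>i=2..m. l ^ (i - 2) * C_pair n \<rho> i powr \<alpha>)
          + l ^ m * (\<Sum>i=m+1..n-1. p powr (real (i - m - 1) * \<alpha> / r) * C_pair n \<rho> i powr \<alpha>)
          + l ^ (m - 1) * p powr (real (n - m - 1) * \<alpha> / r) * C_pair n \<rho> n powr \<alpha>)
  \<and> ((\<forall>i\<in>{2..n-1}. k * C_pair n \<rho> i powr r \<le> C_rest n \<rho> i powr r)
    \<longrightarrow> C_rest n \<rho> 1 powr \<alpha> \<ge>
          p powr (\<alpha> / r) * (\<Sum>i=2..n-1. l ^ (i - 2) * C_pair n \<rho> i powr \<alpha>)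
          + l ^ (n - 2) * C_pair n \<rho> n powr \<alpha>)
  \<and> ((\<forall>j\<in>{2..n-1}. C_pair n \<rho> j powr r \<ge> k * C_rest n \<rho> j powr r)
    \<longrightarrow> C_rest n \<rho> 1 powr \<alpha> \<ge>
          l * (\<Sum>i=2..n-1. p powr (real (i - 2) * \<alpha> / r) * C_pair n \<rho> i powr \<alpha>)
          + p powr (real (n - 2) * \<alpha> / r) * C_pair n \<rho> n powr \<alpha>)"
proof -
  have l0: "0 \<le> l" unfolding l_def using p k r \<alpha> by (intro divide_nonneg_nonneg) (auto intro!: powr_mono2)
  \<comment> \<open>The real exponents become natural powers of a single constant, as the telescoped
    sums require.\<close>
  have cpow: "p powr (real j * \<alpha> / r) = (p powr (\<alpha> / r)) ^ j" for j
    using p by (simp add: powr_powr flip: powr_realpow) (simp add: mult.commute)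
  \<comment> \<open>The remainder after A_(n-1) is the single qubit A_n, of index n - 1, so the
    chain ends in a pair concurrence.\<close>
  have "{n - 1..<n} = {n - 1}" using n3 by auto
  then have last: "C_rest n \<rho> (n - 1) powr \<alpha> = C_pair n \<rho> n powr \<alpha>" by (simp add: C_pair_def C_rest_def)
  note bounds = weighted_sum_bounds[where Q = "\<lambda>i. C_rest n \<rho> i powr \<alpha>" and P = "\<lambda>i. C_pair n \<rho> i powr \<alpha>",
      OF n3 l0 powr_ge_zero last C_rest_powr_step[OF state _ _ k p r \<alpha>, folded l_def]]
  show ?thesis unfolding cpow by (intro conjI impI bounds) auto
qed

end
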